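(* Let $(G,\mathcal{B})$ be a biased graph such that $\mathrm{si}(G)$ is a cycle and $|V(G)|>6$, and let $M=L(G,\mathcal{B})$ be its lift matroid. Then $M$ is $3$-connected if and only if $M$ is simple and at most one edge of $G$ is not in a $2$-cycle. Moreover, if $M$ is $3$-connected, then $M$ is unbreakable.
   Context: Graphs are finite and may have loops and parallel edges; cycles include loops and 2-cycles. A biased graph $(G,\mathcal{B})$ is a graph $G$ with a set $\mathcal{B}$ of cycles (balanced; others unbalanced) such that no theta subgraph contains exactly two cycles of $\mathcal{B}$. The lift matroid $L(G,\mathcal{B})$ is the matroid on $E(G)$ whose circuits are: balanced cycles; theta subgraphs with all cycles unbalanced; tight handcuffs (two edge-disjoint cycles sharing exactly one vertex) with both cycles unbalanced; unions of two vertex-disjoint unbalanced cycles. A matroid is unbreakable if it is connected and $M/F$ is connected for every flat $F$. $\mathrm{si}(G)$ is the simplification of $G$.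
   Formalization: "At most one edge of G is not in a 2-cycle" counts only non-loop edges; counting loops the equivalence fails, e.g. for a 7-cycle with all edges but one doubled, plus one loop, and no balanced cycles, where M is 3-connected. *)

theory Defs
  imports Main
begin

text \<open>Finite undirected multigraphs: \<open>ends e\<close> is the set of end vertices of \<open>e\<close>,
  a singleton exactly when \<open>e\<close> is a loop.\<close>

record ('v, 'e) mgraph =
  verts :: "'v set"
  edges :: "'e set"
  ends :: "'e \<Rightarrow> 'v set"

definition multigraph :: "('v, 'e) mgraph \<Rightarrow> bool" where
  "multigraph G \<longleftrightarrow> finite (verts G) \<and> finite (edges G) \<and>
     (\<forall>e\<in>edges G. ends G e \<subseteq> verts G \<and> card (ends G e) \<in> {1, 2})"

definition is_loop :: "('v, 'e) mgraph \<Rightarrow> 'e \<Rightarrow> bool" where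
  "is_loop G e \<longleftrightarrow> card (ends G e) = 1"

definition vertices_of :: "('v, 'e) mgraph \<Rightarrow> 'e set \<Rightarrow> 'v set" where
  "vertices_of G X = (\<Union>e\<in>X. ends G e)"

text \<open>Cycles, theta subgraphs and handcuffs have no isolated vertices, so they are represented by
  their edge sets. The case \<open>length es = 1\<close> of the following definition is a loop, the case
  \<open>length es = 2\<close> a pair of parallel edges.\<close>

definition is_cycle :: "('v, 'e) mgraph \<Rightarrow> 'e set \<Rightarrow> bool" where
  "is_cycle G C \<longleftrightarrow> (\<exists>vs es. es \<noteq> [] \<and> length vs = length es \<and> distinct vs \<and> distinct es \<and>
     set es \<subseteq> edges G \<and> C = set es \<and>
     (\<forall>i<length es. ends G (es ! i) = {vs ! i, vs ! (Suc i mod length es)}))"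

definition is_path :: "('v, 'e) mgraph \<Rightarrow> 'v list \<Rightarrow> 'e list \<Rightarrow> bool" where
  "is_path G vs es \<longleftrightarrow> length vs = Suc (length es) \<and> distinct vs \<and> set es \<subseteq> edges G \<and>
     (\<forall>i<length es. ends G (es ! i) = {vs ! i, vs ! Suc i})"

definition path_between :: "('v, 'e) mgraph \<Rightarrow> 'v \<Rightarrow> 'v \<Rightarrow> 'v list \<Rightarrow> 'e list \<Rightarrow> bool" where
  "path_between G x y vs es \<longleftrightarrow> is_path G vs es \<and> hd vs = x \<and> last vs = y"

text \<open>A theta: two distinct vertices joined by three internally disjoint paths. Edge-disjointness
  only excludes repeating a path that consists of a single edge.\<close>

definition is_theta :: "('v, 'e) mgraph \<Rightarrow> 'e set \<Rightarrow> bool" where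
  "is_theta G T \<longleftrightarrow> (\<exists>x y vs1 es1 vs2 es2 vs3 es3. x \<noteq> y \<and>
     path_between G x y vs1 es1 \<and> path_between G x y vs2 es2 \<and> path_between G x y vs3 es3 \<and>
     set vs1 \<inter> set vs2 = {x, y} \<and> set vs1 \<inter> set vs3 = {x, y} \<and> set vs2 \<inter> set vs3 = {x, y} \<and>
     set es1 \<inter> set es2 = {} \<and> set es1 \<inter> set es3 = {} \<and> set es2 \<inter> set es3 = {} \<and>
     T = set es1 \<union> set es2 \<union> set es3)"

definition biased_graph :: "('v, 'e) mgraph \<Rightarrow> 'e set set \<Rightarrow> bool" where
  "biased_graph G B \<longleftrightarrow> multigraph G \<and> (\<forall>C\<in>B. is_cycle G C) \<and>
     (\<forall>T. is_theta G T \<longrightarrow> card {C \<in> B. C \<subseteq> T} \<noteq> 2)"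

definition unbalanced_cycle :: "('v, 'e) mgraph \<Rightarrow> 'e set set \<Rightarrow> 'e set \<Rightarrow> bool" where
  "unbalanced_cycle G B C \<longleftrightarrow> is_cycle G C \<and> C \<notin> B"

text \<open>The simplification deletes all loops and keeps one edge of each parallel class; a class is
  represented by the common pair of ends of its members.\<close>

definition simplification :: "('v, 'e) mgraph \<Rightarrow> ('v, 'v set) mgraph" where
  "simplification G =
     \<lparr>verts = verts G, edges = ends G ` {e \<in> edges G. \<not> is_loop G e}, ends = (\<lambda>p. p)\<rparr>"

definition is_cycle_graph :: "('v, 'e) mgraph \<Rightarrow> bool" where
  "is_cycle_graph G \<longleftrightarrow> is_cycle G (edges G) \<and> vertices_of G (edges G) = verts G"

record 'e matroid =
  ground :: "'e set"
  indep :: "'e set \<Rightarrow> bool"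

definition matroid_of_circuits :: "'e set \<Rightarrow> 'e set set \<Rightarrow> 'e matroid" where
  "matroid_of_circuits E \<C> =
     \<lparr>ground = E, indep = (\<lambda>I. I \<subseteq> E \<and> \<not> (\<exists>C\<in>\<C>. C \<subseteq> I))\<rparr>"

definition circuit :: "'e matroid \<Rightarrow> 'e set \<Rightarrow> bool" where
  "circuit M C \<longleftrightarrow> C \<subseteq> ground M \<and> \<not> indep M C \<and> (\<forall>D. D \<subset> C \<longrightarrow> indep M D)"

definition rank :: "'e matroid \<Rightarrow> 'e set \<Rightarrow> nat" where
  "rank M X = Max {card I | I. I \<subseteq> X \<and> indep M I}"

definition basis_of :: "'e matroid \<Rightarrow> 'e set \<Rightarrow> 'e set \<Rightarrow> bool" where
  "basis_of M X A \<longleftrightarrow> A \<subseteq> X \<and> indep M A \<and> (\<forall>e\<in>X - A. \<not> indep M (insert e A))"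

definition closure :: "'e matroid \<Rightarrow> 'e set \<Rightarrow> 'e set" where
  "closure M X = {e \<in> ground M. rank M (insert e X) = rank M X}"

definition flat :: "'e matroid \<Rightarrow> 'e set \<Rightarrow> bool" where
  "flat M F \<longleftrightarrow> F \<subseteq> ground M \<and> closure M F = F"

definition contract :: "'e matroid \<Rightarrow> 'e set \<Rightarrow> 'e matroid" where
  "contract M T =
     \<lparr>ground = ground M - T,
      indep = (\<lambda>I. I \<subseteq> ground M - T \<and> (\<exists>A. basis_of M T A \<and> indep M (I \<union> A)))\<rparr>"

definition simple_matroid :: "'e matroid \<Rightarrow> bool" where
  "simple_matroid M \<longleftrightarrow> (\<forall>C. circuit M C \<longrightarrow> card C \<ge> 3)"

definition connected_matroid :: "'e matroid \<Rightarrow> bool" where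
  "connected_matroid M \<longleftrightarrow>
     (\<forall>e\<in>ground M. \<forall>f\<in>ground M. e \<noteq> f \<longrightarrow> (\<exists>C. circuit M C \<and> e \<in> C \<and> f \<in> C))"

definition unbreakable :: "'e matroid \<Rightarrow> bool" where
  "unbreakable M \<longleftrightarrow>
     connected_matroid M \<and> (\<forall>F. flat M F \<longrightarrow> connected_matroid (contract M F))"

text \<open>Tutte connectivity.\<close>

definition connectivity :: "'e matroid \<Rightarrow> 'e set \<Rightarrow> int" where
  "connectivity M X =
     int (rank M X) + int (rank M (ground M - X)) - int (rank M (ground M))"

definition separation :: "'e matroid \<Rightarrow> nat \<Rightarrow> 'e set \<Rightarrow> bool" where
  "separation M k X \<longleftrightarrow> X \<subseteq> ground M \<and> card X \<ge> k \<and> card (ground M - X) \<ge> k \<and>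
     connectivity M X < int k"

definition n_connected :: "nat \<Rightarrow> 'e matroid \<Rightarrow> bool" where
  "n_connected n M \<longleftrightarrow> (\<forall>k X. 1 \<le> k \<and> k < n \<longrightarrow> \<not> separation M k X)"

definition lift_circuits :: "('v, 'e) mgraph \<Rightarrow> 'e set set \<Rightarrow> 'e set set" where
  "lift_circuits G B =
     B \<union>
     {T. is_theta G T \<and> (\<forall>C. is_cycle G C \<and> C \<subseteq> T \<longrightarrow> unbalanced_cycle G B C)} \<union>
     {C \<union> D | C D. unbalanced_cycle G B C \<and> unbalanced_cycle G B D \<and> C \<inter> D = {} \<and>
        card (vertices_of G C \<inter> vertices_of G D) = 1} \<union>
     {C \<union> D | C D. unbalanced_cycle G B C \<and> unbalanced_cycle G B D \<and>
        vertices_of G C \<inter> vertices_of G D = {}}"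

definition lift_matroid :: "('v, 'e) mgraph \<Rightarrow> 'e set set \<Rightarrow> 'e matroid" where
  "lift_matroid G B = matroid_of_circuits (edges G) (lift_circuits G B)"

definition in_2_cycle :: "('v, 'e) mgraph \<Rightarrow> 'e \<Rightarrow> bool" where
  "in_2_cycle G e \<longleftrightarrow> (\<exists>C. is_cycle G C \<and> card C = 2 \<and> e \<in> C)"

end

theory Submission
  imports Defs
begin

text \<open>The quantity behind most steps is the excess of an edge set, its number of edges minus
  the number of classes that it meets. It is monotone under inclusion, 0 exactly for partial
  transversals, and at least 1 for every cycle that is not a Hamilton cycle. The set
  \<open>B\<close> enters only for sets of \<open>n\<close> edges that meet all \<open>n\<close>
  classes; independent sets are therefore built, wherever possible, so that they miss a class. The
  records of type \<open>matroid\<close> carry no axioms, so heredity, ranks and bases of flats are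
  derived from the explicit independence condition, in locales that know the class map but not the
  graph. The condition on 2-cycles is counted over the nonloop edges, since a loop never lies in a
  2-cycle. A simple M has at most one loop of G, and this loop is unbalanced: it raises the excess
  without meeting a class, just as a second edge of a class already met does.\<close>

text \<open>A theta has one edge more than it has vertices, and if \<open>M\<close> is simple, every balanced cycle is a
  Hamilton cycle. Hence independence of a set of edges depends only on its size, on the number of
  parallel classes it meets and on whether it is a balanced Hamilton cycle, and the rank function is
  explicit. The two sides of a partition of the edges together meet all the classes, and a class missed
  by one side lies in the other, which makes the latter unbalanced unless the class is a single
  edge; this bounds the connectivity. Conversely, two edges outside all 2-cycles form a series pair.
  For unbreakability, the non-spanning flats are the unbalanced unions of classes, the balanced
  Hamilton cycles, and partial transversals of the classes. In the last case two given edges lie in a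
  circuit of the contraction that consists of two, three or four edges or completes the flat to a
  Hamilton cycle with possibly one more edge; the theta property allows this Hamilton cycle
  to be chosen unbalanced.\<close>

section \<open>Partial transversals and rank\<close>

text \<open>This is the rank function of the matroid whose loops are \<open>L\<close> and whose
  parallel classes are the fibres of \<open>cl\<close> outside \<open>L\<close>. Unit increase,
  monotonicity and subadditivity follow.\<close>

definition num_classes :: "('e \<Rightarrow> 'c) \<Rightarrow> 'e set \<Rightarrow> 'e set \<Rightarrow> nat" where
  "num_classes cl L X = card (cl ` (X - L))"

lemma num_classes_empty [simp]: "num_classes cl L {} = 0"
  by (simp add: num_classes_def)

lemma num_classes_insert:
  assumes "finite X"
  shows "num_classes cl L (insert e X) =
    num_classes cl L X + (if e \<in> L \<or> cl e \<in> cl ` (X - L) then 0 else 1)"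
proof (cases "e \<in> L")
  case True
  then have "insert e X - L = X - L" by auto
  then show ?thesis using True by (simp add: num_classes_def)
next
  case False
  then have "insert e X - L = insert e (X - L)" by auto
  then show ?thesis using False assms by (auto simp: num_classes_def card_insert_if)
qed

lemma num_classes_mono:
  assumes "X \<subseteq> Y" "finite Y"
  shows "num_classes cl L X \<le> num_classes cl L Y"
  unfolding num_classes_def using assms by (intro card_mono) auto

lemma num_classes_le_card:
  assumes "finite X"
  shows "num_classes cl L X \<le> card X"
  unfolding num_classes_def using assms
  by (meson Diff_subset card_image_le card_mono finite_Diff order_trans)

lemma num_classes_Un_le: "num_classes cl L (X \<union> Y) \<le> num_classes cl L X + num_classes cl L Y"
  unfolding num_classes_def Un_Diff image_Un by (rule card_Un_le)

text \<open>Each added edge meets at most one new class, so the excess (the nullity in the matroid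
  of \<open>num_classes\<close>) cannot drop. The inequality is written with sums to avoid truncated
  subtraction.\<close>

lemma num_classes_excess_mono:
  assumes "X \<subseteq> Y" "finite Y"
  shows "num_classes cl L Y + card X \<le> num_classes cl L X + card Y"
proof -
  have "num_classes cl L Y \<le> num_classes cl L X + num_classes cl L (Y - X)"
    using num_classes_Un_le[of cl L X "Y - X"] assms by (simp add: Un_absorb1)
  also have "num_classes cl L (Y - X) \<le> card (Y - X)"
    using assms by (intro num_classes_le_card) auto
  also have "card (Y - X) = card Y - card X"
    using assms by (meson card_Diff_subset finite_subset)
  moreover have "card X \<le> card Y"
    using assms by (simp add: card_mono)
  ultimately show ?thesis
    by linarith
qed

lemma num_classes_eq_card_iff:
  assumes "finite X"
  shows "num_classes cl L X = card X \<longleftrightarrow> X \<inter> L = {} \<and> inj_on cl X"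
proof
  assume eq: "num_classes cl L X = card X"
  have "card (cl ` (X - L)) \<le> card (X - L)" "card (X - L) \<le> card X"
    using assms by (auto intro: card_image_le card_mono)
  then have "card (X - L) = card X" "card (cl ` (X - L)) = card (X - L)"
    using eq by (auto simp: num_classes_def)
  then have "X - L = X" "inj_on cl (X - L)"
    using assms by (auto simp: card_subset_eq eq_card_imp_inj_on)
  then show "X \<inter> L = {} \<and> inj_on cl X" by auto
next
  assume "X \<inter> L = {} \<and> inj_on cl X"
  then show "num_classes cl L X = card X"
    by (simp add: num_classes_def Diff_triv card_image)
qed

lemma extend_transversal:
  assumes "S \<subseteq> X - L" "inj_on cl S"
  obtains T where "S \<subseteq> T" "T \<subseteq> X - L" "inj_on cl T" "cl ` T = cl ` (X - L)"
proof -
  define R where "R = cl ` (X - L) - cl ` S"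
  define g where "g = inv_into (X - L) cl"
  have g: "g c \<in> X - L" "cl (g c) = c" if "c \<in> R" for c
    using that by (auto simp: R_def g_def intro: f_inv_into_f) (metis Diff_iff image_eqI inv_into_into)+
  have "inj_on cl (S \<union> g ` R)"
    unfolding inj_on_Un
  proof (intro conjI)
    show "inj_on cl (g ` R)"
      using g by (auto simp: inj_on_def)
    show "cl ` (S - g ` R) \<inter> cl ` (g ` R - S) = {}"
    proof -
      have "cl s \<noteq> cl (g c)" if "s \<in> S" "c \<in> R" for s c
        using g(2)[OF that(2)] that by (metis Diff_iff R_def image_eqI)
      then show ?thesis by (auto simp: disjoint_iff)
    qed
  qed (use assms in auto)
  moreover have "cl ` (S \<union> g ` R) = cl ` (X - L)"
  proof -
    have "cl ` g ` R = R" using g by (force simp: image_image)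
    then show ?thesis using assms by (auto simp: image_Un R_def)
  qed
  ultimately show ?thesis
    using that[of "S \<union> g ` R"] assms g by auto
qed

section \<open>Ranks, circuits and connectivity without matroid axioms\<close>

lemma rank_eqI:
  assumes "finite X" "I \<subseteq> X" "indep M I" "card I = r"
    and "\<And>J. J \<subseteq> X \<Longrightarrow> indep M J \<Longrightarrow> card J \<le> r"
  shows "rank M X = r"
  unfolding rank_def
proof (rule Max_eqI)
  have "{card I |I. I \<subseteq> X \<and> indep M I} \<subseteq> card ` Pow X" by auto
  then show "finite {card I |I. I \<subseteq> X \<and> indep M I}"
    using assms(1) by (meson finite_Pow_iff finite_imageI finite_subset)
qed (use assms in auto)

lemma card_le_rank:
  assumes "finite X" "I \<subseteq> X" "indep M I"
  shows "card I \<le> rank M X"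
  unfolding rank_def
proof (rule Max_ge)
  have "{card I |I. I \<subseteq> X \<and> indep M I} \<subseteq> card ` Pow X" by auto
  then show "finite {card I |I. I \<subseteq> X \<and> indep M I}"
    using assms(1) by (meson finite_Pow_iff finite_imageI finite_subset)
qed (use assms in auto)

text \<open>Nothing in the record type makes the empty set independent. Assuming it ensures that the
  maximum in \<open>rank\<close> is taken over a nonempty set.\<close>

lemma obtain_rank:
  assumes "finite X" "indep M {}"
  obtains I where "I \<subseteq> X" "indep M I" "card I = rank M X"
proof -
  have "{card I |I. I \<subseteq> X \<and> indep M I} \<subseteq> card ` Pow X" by auto
  then have "finite {card I |I. I \<subseteq> X \<and> indep M I}"
    using assms(1) by (meson finite_Pow_iff finite_imageI finite_subset)
  moreover have "{card I |I. I \<subseteq> X \<and> indep M I} \<noteq> {}"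
    using assms(2) by auto
  ultimately have "rank M X \<in> {card I |I. I \<subseteq> X \<and> indep M I}"
    unfolding rank_def by (rule Max_in)
  then show ?thesis using that by auto
qed

lemma rank_mono:
  assumes "finite Y" "X \<subseteq> Y" "indep M {}"
  shows "rank M X \<le> rank M Y"
proof -
  obtain I where "I \<subseteq> X" "indep M I" "card I = rank M X"
    using obtain_rank assms by (metis finite_subset)
  then show ?thesis using card_le_rank assms by (metis order_trans)
qed

lemma rank_le_card:
  assumes "finite X" "indep M {}"
  shows "rank M X \<le> card X"
  using assms by (metis obtain_rank card_mono)

lemma rank_less_card:
  assumes "finite X" "indep M {}" "\<not> indep M X"
  shows "rank M X < card X"
proof -
  obtain I where "I \<subseteq> X" "indep M I" "card I = rank M X"
    using obtain_rank assms by metis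
  then show ?thesis using assms by (metis psubsetI psubset_card_mono)
qed

lemma obtain_circuit:
  assumes "finite X" "X \<subseteq> ground M" "\<not> indep M X"
  obtains C where "C \<subseteq> X" "circuit M C"
proof -
  have "\<exists>C. C \<subseteq> X \<and> circuit M C"
    using assms
  proof (induction rule: finite_psubset_induct)
    case (psubset X)
    show ?case
    proof (cases "\<forall>D. D \<subset> X \<longrightarrow> indep M D")
      case True
      then show ?thesis using psubset by (auto simp: circuit_def)
    next
      case False
      then obtain D where "D \<subset> X" "\<not> indep M D" by blast
      then show ?thesis using psubset.IH[of D] psubset.prems by blast
    qed
  qed
  then show ?thesis using that by blast
qed

text \<open>A circuit \<open>C\<close> of one or two elements has rank below \<open>card C\<close>,
  so \<open>C\<close> itself is a \<open>card C\<close>-separation; four elements in the ground set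
  leave a large enough complement.\<close>

lemma n_connected_3_imp_simple:
  assumes "finite (ground M)" "card (ground M) \<ge> 4" "indep M {}" "n_connected 3 M"
  shows "simple_matroid M"
  unfolding simple_matroid_def
proof (intro allI impI, rule ccontr)
  fix C assume C: "circuit M C" and "\<not> 3 \<le> card C"
  define k where "k = card C"
  have sub: "C \<subseteq> ground M" and dep: "\<not> indep M C"
    using C by (auto simp: circuit_def)
  then have fin: "finite C" and "C \<noteq> {}"
    using assms finite_subset by auto
  then have k: "1 \<le> k" "k < 3"
    using \<open>\<not> 3 \<le> card C\<close> by (auto simp: k_def Suc_le_eq card_gt_0_iff)
  have "rank M C < k"
    unfolding k_def by (rule rank_less_card) (use fin dep assms in auto)
  moreover have "rank M (ground M - C) \<le> rank M (ground M)"
    by (rule rank_mono) (use assms in auto)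
  ultimately have "connectivity M C < int k"
    by (simp add: connectivity_def)
  moreover have "card (ground M - C) \<ge> k"
    using assms(2) k sub fin by (simp add: card_Diff_subset k_def)
  ultimately have "separation M k C"
    using sub by (simp add: separation_def k_def)
  then show False
    using assms(4) k by (auto simp: n_connected_def)
qed

section \<open>Rank and connectivity of the lift matroid\<close>

text \<open>\<open>L\<close> is the set of loops of the graph, \<open>cl\<close> sends an edge to its parallel class and \<open>n\<close> is the
  number of parallel classes. If the lift matroid is simple, a set of edges is independent if and
  only if it misses a class and has at most one edge more than it has classes, or it is an
  unbalanced Hamilton cycle. The assumption \<open>swap\<close> is what remains of the theta property.\<close>

locale cyclic_lift =
  fixes M :: "'e matroid" and L :: "'e set" and cl :: "'e \<Rightarrow> 'c" and B :: "'e set set" and n :: nat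
  assumes fin: "finite (ground M)"
    and n_eq: "num_classes cl L (ground M) = n"
    and n_ge: "7 \<le> n"
    and indep_iff: "indep M I \<longleftrightarrow> I \<subseteq> ground M \<and>
      (num_classes cl L I < n \<and> card I \<le> num_classes cl L I + 1 \<or>
       num_classes cl L I = n \<and> card I = n \<and> I \<notin> B)"
    and swap: "\<lbrakk>H \<subseteq> ground M; num_classes cl L H = n; card H = n; H \<in> B; x \<in> H; y \<in> ground M - H;
      y \<notin> L; cl x = cl y\<rbrakk> \<Longrightarrow> insert y (H - {x}) \<notin> B"
begin

abbreviation "E \<equiv> ground M"
abbreviation "a \<equiv> num_classes cl L"

lemma finE: "X \<subseteq> E \<Longrightarrow> finite X"
  using fin finite_subset by blast

lemma a_le_n: "X \<subseteq> E \<Longrightarrow> a X \<le> n"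
  using num_classes_mono[OF _ fin, of X cl L] n_eq by simp

lemma a_le_card: "X \<subseteq> E \<Longrightarrow> a X \<le> card X"
  by (rule num_classes_le_card[OF finE])

lemma indep_empty: "indep M {}"
  using n_ge by (simp add: indep_iff)

text \<open>Sets that miss a class inherit independence because excess is monotone. A proper subset
  of an unbalanced Hamilton cycle has fewer than \<open>n\<close> edges, so it misses a class and
  still has excess 0.\<close>

lemma indep_mono:
  assumes "indep M J" "I \<subseteq> J"
  shows "indep M I"
proof (cases "I = J")
  case False
  have fJ: "finite J" and J: "J \<subseteq> E" using assms finE by (auto simp: indep_iff)
  have "a J + card I \<le> a I + card J" "a I \<le> a J"
    using num_classes_excess_mono[OF assms(2) fJ] num_classes_mono[OF assms(2) fJ] by auto
  moreover have "card I < card J"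
    using assms False fJ by (metis psubsetI psubset_card_mono)
  moreover have "a I \<le> card I"
    using num_classes_le_card finite_subset[OF assms(2) fJ] by blast
  ultimately show ?thesis
    using assms J unfolding indep_iff[of J] indep_iff[of I] by auto
qed (use assms in simp)

text \<open>A set with exactly as many edges as classes is a partial transversal of the classes.\<close>

lemma transversal:
  assumes "S \<subseteq> X" "X \<subseteq> E" "a S = card S"
  obtains T where "S \<subseteq> T" "T \<subseteq> X" "a T = card T" "card T = a X" "cl ` (T - L) = cl ` (X - L)"
proof -
  have "S \<inter> L = {} \<and> inj_on cl S"
    using num_classes_eq_card_iff[OF finE[OF subset_trans[OF assms(1,2)]], of cl L] assms(3) by simp
  then have S: "S \<subseteq> X - L" "inj_on cl S" using assms(1) by auto
  obtain T where T: "S \<subseteq> T" "T \<subseteq> X - L" "inj_on cl T" "cl ` T = cl ` (X - L)"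
    by (rule extend_transversal[OF S])
  then have TL: "T \<inter> L = {}" "T - L = T" "T \<subseteq> E" using assms(2) by auto
  then have "a T = card T"
    using num_classes_eq_card_iff[OF finE[OF TL(3)], of cl L] T(3) by simp
  moreover have "card T = a X"
    using T card_image[of cl T] by (simp add: num_classes_def)
  ultimately show ?thesis
    by (intro that[of T]) (use T TL in auto)
qed

text \<open>A transversal of the classes met by \<open>X\<close> accounts for \<open>a X\<close>,
  and positive excess, which signals an unbalanced cycle, adds one. Once all classes are met the
  value is capped at \<open>n\<close>, and only a balanced Hamilton cycle falls short of it.\<close>

lemma rank_eq:
  assumes X: "X \<subseteq> E"
  shows "rank M X = (if a X < n then a X + (if a X < card X then 1 else 0)
    else if card X = n \<and> X \<in> B then n - 1 else n)"
proof -
  have fX: "finite X" using finE X by auto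
  obtain T where T: "T \<subseteq> X" "a T = card T" "card T = a X" "cl ` (T - L) = cl ` (X - L)"
    using transversal[OF empty_subsetI X] by (metis card.empty num_classes_empty)
  have TE: "T \<subseteq> E" "finite T" using T X finE by auto
  have upper: "card J \<le> a X + 1" "card J \<le> n" "a J = n \<longrightarrow> J \<notin> B \<and> card J = n"
    if "J \<subseteq> X" "indep M J" for J
    using that(2) num_classes_mono[OF that(1) fX, of cl L] unfolding indep_iff by auto
  have ex: "a X + card J \<le> a J + card X" "a J \<le> a X" if "J \<subseteq> X" for J
    using num_classes_excess_mono[of J X cl L] num_classes_mono[of J X cl L] that fX by blast+
  have aX: "a X \<le> card X" using num_classes_le_card fX by blast
  consider (small) "a X < n" "\<not> a X < card X" | (extra) "a X < n" "a X < card X"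
    | (bal) "a X = n" "card X = n" "X \<in> B" | (unbal) "a X = n" "card X = n" "X \<notin> B"
    | (big) "a X = n" "card X > n"
    using a_le_n[OF X] aX by (cases "X \<in> B"; linarith)
  then show ?thesis
  proof cases
    case small
    have "indep M X" using small X aX by (simp add: indep_iff)
    then have "rank M X = a X"
      using small aX by (intro rank_eqI[OF fX subset_refl]) (auto intro: card_mono[OF fX])
    then show ?thesis using small by simp
  next
    case extra
    obtain x where x: "x \<in> X - T"
      using T extra card_mono[of T X] TE by (cases "X \<subseteq> T") auto
    have "a (insert x T) = a T"
      using num_classes_insert[of T cl L x] TE T x by auto
    then have "indep M (insert x T)" "card (insert x T) = a X + 1"
      using T TE extra x X by (auto simp: indep_iff)
    then have "rank M X = a X + 1"
      using x T(1) by (intro rank_eqI[OF fX _ _ _ upper(1)]) auto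
    then show ?thesis using extra by simp
  next
    case bal
    obtain x where x: "x \<in> X" using bal n_ge by fastforce
    have "a X + card (X - {x}) \<le> a (X - {x}) + card X"
      by (rule ex) auto
    moreover have cx: "card (X - {x}) = n - 1"
      using bal(2) x fX by simp
    moreover have "a (X - {x}) \<le> card (X - {x})"
      using num_classes_le_card fX by blast
    ultimately have "a (X - {x}) = n - 1" using bal(1,2) by linarith
    then have ind: "indep M (X - {x})"
      using cx X n_ge by (auto simp: indep_iff)
    have le: "card J \<le> n - 1" if "J \<subseteq> X" "indep M J" for J
    proof -
      have "J \<noteq> X" using bal that by (auto simp: indep_iff)
      then have "card J < card X" using that fX by (simp add: psubsetI psubset_card_mono)
      then show ?thesis using bal by auto
    qed
    have "rank M X = n - 1"
      by (rule rank_eqI[OF fX _ ind cx le]) auto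
    then show ?thesis using bal by simp
  next
    case unbal
    have "indep M X" using unbal X by (simp add: indep_iff)
    then have "rank M X = n"
      by (rule rank_eqI[OF fX subset_refl _ unbal(2) upper(2)])
    then show ?thesis using unbal by simp
  next
    case big
    obtain x where x: "x \<in> X - T"
      using T big card_mono[of T X] TE by (cases "X \<subseteq> T") auto
    have inj: "inj_on cl T" "T \<inter> L = {}"
      using num_classes_eq_card_iff[of T cl L] T TE by auto
    \<comment> \<open>The transversal \<open>T\<close> may be a balanced Hamilton cycle. Exchanging
      an edge \<open>t\<close> outside the class of \<open>x\<close> for \<open>x\<close> gives
      \<open>n\<close> edges that meet \<open>n - 1\<close> classes, which are independent whatever
      \<open>B\<close> is.\<close>
    have "card {t \<in> T. cl t = cl x} \<le> 1"
      using inj TE by (auto simp: card_le_Suc0_iff_eq inj_on_def)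
    then have "{t \<in> T. cl t = cl x} \<noteq> T" using T big n_ge by auto
    then obtain t where t: "t \<in> T" "cl t \<noteq> cl x" by auto
    have aTt: "a (T - {t}) = card (T - {t})"
      using num_classes_eq_card_iff[of "T - {t}" cl L] TE inj by (auto intro: inj_on_subset)
    have ct: "card (T - {t}) = n - 1" using T t big TE by auto
    have "x \<in> L \<or> cl x \<in> cl ` (T - {t} - L)"
    proof (cases "x \<in> L")
      case False
      then have "cl x \<in> cl ` (T - L)" using x T by auto
      then show ?thesis using t by auto
    qed simp
    then have "a (insert x (T - {t})) = n - 1"
      using num_classes_insert[of "T - {t}" cl L x] TE aTt ct by auto
    moreover have ci: "card (insert x (T - {t})) = n"
      using x TE ct n_ge by auto
    ultimately have "indep M (insert x (T - {t}))"
      using n_ge x TE X by (auto simp: indep_iff)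
    then have "rank M X = n"
      using x T(1) ci by (intro rank_eqI[OF fX _ _ _ upper(2)]) auto
    then show ?thesis using big by simp
  qed
qed

section \<open>Thin edges, the nonloop edges outside all 2-cycles, and necessity\<close>

definition thin :: "'e \<Rightarrow> bool" where
  "thin e \<longleftrightarrow> e \<in> E - L \<and> (\<forall>f\<in>E - L. cl f = cl e \<longrightarrow> f = e)"

lemma thin_class_notin:
  assumes "thin e" "X \<subseteq> E" "e \<notin> X"
  shows "cl e \<notin> cl ` (X - L)"
proof
  assume "cl e \<in> cl ` (X - L)"
  then obtain x where x: "cl e = cl x" "x \<in> X - L" by (rule imageE)
  then have "x = e" using assms(1,2) unfolding thin_def by (metis DiffD1 DiffD2 DiffI subsetD)
  then show False using assms(3) x by blast
qed

text \<open>An independent set avoiding \<open>e\<close> and \<open>f\<close> misses both their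
  classes. Adding \<open>e\<close> does not change its excess and still leaves the class of
  \<open>f\<close> missed, so independence is kept. Hence deleting \<open>{e, f}\<close> lowers the
  rank, and \<open>{e, f}\<close> has connectivity at most 1.\<close>

lemma not_3_connected_two_thin:
  assumes "thin e" "thin f" "e \<noteq> f"
  shows "\<not> n_connected 3 M"
proof
  assume *: "n_connected 3 M"
  have ef: "e \<in> E" "f \<in> E" "e \<notin> L" "f \<notin> L" using assms by (auto simp: thin_def)
  obtain I where I: "I \<subseteq> E - {e, f}" "indep M I" "card I = rank M (E - {e, f})"
    using obtain_rank[of "E - {e, f}"] fin indep_empty by auto
  have fI: "finite I" using I finE by blast
  have e: "a (insert e I) = a I + 1"
    using num_classes_insert[OF fI, of cl L e] thin_class_notin[of e I] I(1) ef assms(1) by auto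
  have f: "a (insert f (insert e I)) = a I + 2"
  proof -
    have "cl f \<notin> cl ` (insert e I - L)"
      using thin_class_notin[of f "insert e I"] I(1) ef assms by auto
    then show ?thesis
      using num_classes_insert[of "insert e I" cl L f] fI ef e by auto
  qed
  have "a (insert f (insert e I)) \<le> n" by (rule a_le_n) (use I ef in auto)
  then have "a I + 2 \<le> n" using f by simp
  moreover have ci: "card (insert e I) = card I + 1"
    using I(1) fI by (auto simp: card_insert_if)
  ultimately have "indep M (insert e I)"
    using I e ef by (auto simp: indep_iff)
  then have "card (insert e I) \<le> rank M E"
    by (intro card_le_rank) (use fin I ef in auto)
  moreover have "rank M {e, f} \<le> 2"
    using rank_le_card[of "{e, f}" M] indep_empty assms(3) by simp
  ultimately have "connectivity M {e, f} < int 2"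
    using I ci by (simp add: connectivity_def)
  moreover have "card (E - {e, f}) \<ge> 2"
  proof -
    have "n \<le> card E" using n_eq num_classes_le_card[OF fin] by metis
    then show ?thesis
      using card_Diff_subset[of "{e, f}" E] ef assms n_ge by auto
  qed
  ultimately have "separation M 2 {e, f}"
    using ef assms by (auto simp: separation_def)
  then show False using * by (auto simp: n_connected_def)
qed

end

section \<open>Sufficiency: ranks of the two sides of a partition\<close>

locale thick_cyclic_lift = cyclic_lift +
  assumes thin_unique: "thin e \<Longrightarrow> thin f \<Longrightarrow> e = f"
begin

text \<open>A class missed by \<open>Y\<close> lies wholly in the complement, where excess 0 leaves
  room for only one of its edges.\<close>

lemma missed_class_thin:
  assumes "Y \<subseteq> E" "a (E - Y) = card (E - Y)" "e \<in> E - L" "cl e \<notin> cl ` (Y - L)"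
  shows "thin e"
proof -
  have "inj_on cl (E - Y)"
    using num_classes_eq_card_iff[of "E - Y" cl L] assms fin by auto
  moreover have "e \<in> E - Y" using assms by auto
  moreover have "f \<in> E - Y" if "f \<in> E - L" "cl f = cl e" for f
    using that assms(4) by (metis Diff_iff image_eqI)
  ultimately show ?thesis
    using assms(3) unfolding thin_def inj_on_def by blast
qed

lemma miss_one:
  assumes "Y \<subseteq> E" "a Y < n"
  obtains e where "e \<in> E - L" "cl e \<notin> cl ` (Y - L)"
proof -
  have "\<not> cl ` (E - L) \<subseteq> cl ` (Y - L)"
    using card_mono[of "cl ` (Y - L)" "cl ` (E - L)"] finE[OF assms(1)] assms(2) n_eq
    by (auto simp: num_classes_def)
  then show ?thesis using that by auto
qed

lemma miss_two:
  assumes "Y \<subseteq> E" "a Y + 2 \<le> n"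
  obtains e f where "e \<in> E - L" "f \<in> E - L" "cl e \<noteq> cl f" "cl e \<notin> cl ` (Y - L)" "cl f \<notin> cl ` (Y - L)"
proof -
  have fY: "finite (cl ` (Y - L))" using assms finE by auto
  have "card (cl ` (E - L) - cl ` (Y - L)) = n - a Y"
    using card_Diff_subset[OF fY, of "cl ` (E - L)"] assms n_eq unfolding num_classes_def by auto
  then have "2 \<le> card (cl ` (E - L) - cl ` (Y - L))" using assms by auto
  then obtain Z where Z: "Z \<subseteq> cl ` (E - L) - cl ` (Y - L)" "card Z = 2"
    by (meson obtain_subset_with_card_n)
  then obtain c d where "Z = {c, d}" "c \<noteq> d" by (auto simp: card_2_iff)
  then show ?thesis using that Z by auto
qed

text \<open>Two classes missed by \<open>Y\<close> lie wholly in the complement, and at most one of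
  them is a single edge.\<close>

lemma excess_complement:
  assumes "Y \<subseteq> E" "a Y + 2 \<le> n"
  shows "a (E - Y) < card (E - Y)"
proof (rule ccontr)
  assume "\<not> ?thesis"
  then have eq: "a (E - Y) = card (E - Y)"
    using num_classes_le_card[of "E - Y" cl L] fin by auto
  obtain e f where "e \<in> E - L" "f \<in> E - L" "cl e \<noteq> cl f" "cl e \<notin> cl ` (Y - L)" "cl f \<notin> cl ` (Y - L)"
    using miss_two assms by blast
  then show False
    using missed_class_thin[OF assms(1) eq] thin_unique by metis
qed

lemma rank_ground: "rank M E = n"
proof -
  have "n < card E"
    using excess_complement[of "{}"] n_eq n_ge by simp
  then show ?thesis using rank_eq[of E] n_eq by auto
qed

text \<open>If both sides miss a class and have positive excess, each rank is the class number plus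
  one, and the class numbers add up to at least \<open>n\<close>. Otherwise one side has rank
  \<open>n\<close> and rank 2 on the other side suffices, or the ranks are at least
  \<open>n - 1\<close> and 3.\<close>

lemma rank_sum_ge:
  assumes XY: "X \<union> Y = E" "X \<inter> Y = {}"
    and rX: "2 \<le> rank M X" and rY: "2 \<le> rank M Y"
  shows "n + 2 \<le> rank M X + rank M Y"
proof -
  have full: "n + 2 \<le> rank M X + rank M Y"
    if XY: "X \<union> Y = E" "X \<inter> Y = {}" and rY: "2 \<le> rank M Y" and aX: "a X = n" for X Y
  proof (cases "a Y \<le> 2")
    case True
    have "E - Y = X" "Y \<subseteq> E" "X \<subseteq> E" using XY by auto
    then have "n < card X" using excess_complement[of Y] True n_ge aX by auto
    then show ?thesis using rank_eq[of X] \<open>X \<subseteq> E\<close> aX rY by auto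
  next
    case False
    have "Y \<subseteq> E" "X \<subseteq> E" using XY by auto
    then have "3 \<le> rank M Y" "n - 1 \<le> rank M X"
      using rank_eq[of Y] rank_eq[of X] False aX n_ge by auto
    then show ?thesis using n_ge by linarith
  qed
  have tight: "n + 2 \<le> rank M X + rank M Y"
    if XY: "X \<union> Y = E" "X \<inter> Y = {}" and rY: "2 \<le> rank M Y" and lt: "a X < n" "a Y < n"
      and eY: "a Y = card Y" for X Y
  proof -
    have sub: "E - X = Y" "E - Y = X" "Y \<subseteq> E" "X \<subseteq> E" using XY by auto
    \<comment> \<open>Two classes missed by \<open>X\<close> would lie in \<open>Y\<close> and give
      it positive excess.\<close>
    have "\<not> a X + 2 \<le> n" using excess_complement[of X] sub eY by auto
    then have aX: "a X = n - 1" using \<open>a X < n\<close> by auto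
    obtain e where e: "e \<in> E - L" "cl e \<notin> cl ` (X - L)"
      by (rule miss_one[OF sub(4) lt(1)])
    obtain f where f: "f \<in> E - L" "cl f \<notin> cl ` (Y - L)"
      by (rule miss_one[OF sub(3) lt(2)])
    \<comment> \<open>If both sides had excess 0, \<open>e\<close> and \<open>f\<close> would both
      be thin, hence equal, although they lie on opposite sides.\<close>
    have "a X < card X"
    proof (rule ccontr)
      assume "\<not> ?thesis"
      then have "a X = card X" using num_classes_le_card[of X cl L] sub finE[of X] by auto
      then have "thin e" "thin f"
        using missed_class_thin[of X e] missed_class_thin[of Y f] e f sub eY by auto
      then have "e = f" using thin_unique by auto
      then show False using e f XY by blast
    qed
    then have "rank M X = n" using rank_eq[of X] aX sub n_ge by auto
    then show ?thesis using rY by auto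
  qed
  have sub: "X \<subseteq> E" "Y \<subseteq> E" using XY by auto
  then have le: "a X \<le> n" "a Y \<le> n" "a X \<le> card X" "a Y \<le> card Y"
    by (simp_all add: a_le_n a_le_card)
  have sum: "n \<le> a X + a Y" using num_classes_Un_le[of cl L X Y] n_eq XY by auto
  consider "a X = n" | "a Y = n" | "a X < n" "a Y < n" "a Y = card Y"
    | "a X < n" "a Y < n" "a X = card X" | "a X < n" "a Y < n" "a Y < card Y" "a X < card X"
    using le by linarith
  then show ?thesis
  proof cases
    case 1 then show ?thesis using full XY rY by blast
  next
    case 2 then show ?thesis using full[of Y X] XY rX by (simp add: Un_commute Int_commute)
  next
    case 3 then show ?thesis using tight XY rY by blast
  next
    case 4 then show ?thesis using tight[of Y X] XY rX by (simp add: Un_commute Int_commute)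
  next
    case 5 then show ?thesis using rank_eq[of X] rank_eq[of Y] sub sum by auto
  qed
qed

text \<open>In a simple matroid a side with at least two elements has rank at least 2, as
  \<open>rank_sum_ge\<close> requires. The complement of a single element has positive excess and
  misses at most one class, so its rank is \<open>n\<close>.\<close>

lemma three_connected:
  assumes "simple_matroid M"
  shows "n_connected 3 M"
  unfolding n_connected_def
proof (intro allI impI notI)
  fix k X assume k: "1 \<le> k \<and> k < 3" and sep: "separation M k X"
  define Y where "Y = E - X"
  have XY: "X \<union> Y = E" "X \<inter> Y = {}" and sub: "X \<subseteq> E" "Y \<subseteq> E"
    using sep by (auto simp: separation_def Y_def)
  have cards: "k \<le> card X" "k \<le> card Y" and conn: "rank M X + rank M Y < n + k"
    using sep rank_ground by (auto simp: separation_def Y_def connectivity_def)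
  have small: "indep M Z" if "Z \<subseteq> E" "card Z \<le> 2" for Z
  proof (rule ccontr)
    assume "\<not> indep M Z"
    then obtain C where "C \<subseteq> Z" "circuit M C"
      by (rule obtain_circuit[OF finE[OF \<open>Z \<subseteq> E\<close>] \<open>Z \<subseteq> E\<close>])
    then show False
      using assms that card_mono[of Z C] finE[of Z] by (fastforce simp: simple_matroid_def)
  qed
  have rank_ge: "min 2 (card Z) \<le> rank M Z" if "Z \<subseteq> E" for Z
  proof -
    obtain W where W: "W \<subseteq> Z" "card W = min 2 (card Z)"
      by (meson min.cobounded2 obtain_subset_with_card_n)
    then have "indep M W" using that by (intro small) auto
    then show ?thesis using card_le_rank[OF finE[OF that] W(1)] W(2) by simp
  qed
  have one: "n + 1 \<le> rank M X + rank M Y" if "X \<union> Y = E" "X \<inter> Y = {}" "card X = 1" for X Y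
  proof -
    have *: "E - X = Y" "X \<subseteq> E" "Y \<subseteq> E" using that by auto
    have "a X \<le> 1" using a_le_card[OF *(2)] that(3) by simp
    then have aY: "a Y < card Y" "n - 1 \<le> a Y"
      using excess_complement[OF *(2)] num_classes_Un_le[of cl L X Y] n_eq n_ge *(1) that(1) by auto
    have "n \<le> rank M Y"
      using rank_eq[OF *(3)] a_le_n[OF *(3)] aY by auto
    moreover have "1 \<le> rank M X" using rank_ge[OF *(2)] that(3) by simp
    ultimately show ?thesis by simp
  qed
  show False
  proof (cases "card X = 1 \<or> card Y = 1")
    case True
    then have "n + 1 \<le> rank M X + rank M Y" "k = 1"
      using one[of X Y] one[of Y X] XY cards k by (auto simp: Un_commute Int_commute)
    then show False using conn by auto
  next
    case False
    then have "2 \<le> rank M X" "2 \<le> rank M Y"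
      using rank_ge[OF sub(1)] rank_ge[OF sub(2)] cards k by auto
    then have "n + 2 \<le> rank M X + rank M Y"
      by (rule rank_sum_ge[OF XY])
    then show False using conn k by auto
  qed
qed

section \<open>Contractions by flats\<close>

lemma miss_thick:
  assumes "Y \<subseteq> E" "a Y + 2 \<le> n"
  obtains g where "g \<in> E - L" "cl g \<notin> cl ` (Y - L)" "\<not> thin g"
proof -
  obtain e f where *: "e \<in> E - L" "f \<in> E - L" "cl e \<noteq> cl f" "cl e \<notin> cl ` (Y - L)" "cl f \<notin> cl ` (Y - L)"
    by (rule miss_two[OF assms])
  show ?thesis
  proof (cases "thin e")
    case True
    then have "\<not> thin f" using thin_unique[of e f] *(3) by auto
    then show ?thesis using *(2,5) by (rule that[rotated 2])
  next
    case False
    then show ?thesis using *(1,4) by (rule that[rotated 2])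
  qed
qed

section \<open>Relative circuits over partial transversals\<close>

lemma partner:
  assumes "e \<in> E - L" "\<not> thin e"
  obtains f where "f \<in> E - L" "f \<noteq> e" "cl f = cl e"
  using assms unfolding thin_def by blast

lemma a_insert: "X \<subseteq> E \<Longrightarrow>
    a (insert e X) = a X + (if e \<in> L \<or> cl e \<in> cl ` (X - L) then 0 else 1)"
  by (rule num_classes_insert[OF finE])

lemma a_insert_covered:
  assumes "X \<subseteq> E" "e \<in> L \<or> cl e \<in> cl ` (X - L)"
  shows "a (insert e X) = a X"
  using a_insert[OF assms(1), of e] assms(2) by simp

lemma a_insert_new:
  assumes "X \<subseteq> E" "e \<notin> L" "cl e \<notin> cl ` (X - L)"
  shows "a (insert e X) = a X + 1"
  using a_insert[OF assms(1), of e] assms(2,3) by simp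

lemma partial_transversal_subset:
  assumes "X \<subseteq> E" "a X = card X" "Y \<subseteq> X"
  shows "a Y = card Y"
  using num_classes_excess_mono[OF assms(3) finE[OF assms(1)], of cl L] assms(2)
    a_le_card[of Y] assms(1,3) by auto

lemma partial_transversalD:
  assumes "X \<subseteq> E" "a X = card X"
  shows "X \<inter> L = {}" "inj_on cl X"
  using num_classes_eq_card_iff[OF finE[OF assms(1)], of cl L] assms(2) by auto

lemma indep_card_le: "indep M I \<Longrightarrow> card I \<le> n"
  unfolding indep_iff by auto

lemma full_classes:
  assumes "T \<subseteq> E" "a T = n"
  shows "cl ` (T - L) = cl ` (E - L)"
  using assms fin n_eq unfolding num_classes_def
  by (intro card_subset_eq) auto

text \<open>For independent \<open>F\<close> these are circuits of the contraction by
  \<open>F\<close>, see \<open>circuit_contract\<close>. Adjoining all of \<open>F\<close> avoids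
  the choice of a basis in \<open>contract\<close>, and by heredity only deletions of single
  elements need testing.\<close>

definition rel_circuit :: "'a set \<Rightarrow> 'a set \<Rightarrow> bool" where
  "rel_circuit F C \<longleftrightarrow> C \<subseteq> E - F \<and> \<not> indep M (C \<union> F) \<and> (\<forall>x\<in>C. indep M (C - {x} \<union> F))"

text \<open>While a class is missed, excess 2 is dependent and excess 1 is independent. By
  \<open>cov\<close> the removal of an element of \<open>C\<close> loses no class, so it lowers the
  excess from 2 to 1.\<close>

lemma rel_circuitI:
  assumes "C \<subseteq> E - F" "F \<subseteq> E" "a (C \<union> F) < n" "card C + card F = a (C \<union> F) + 2"
    and cov: "\<And>x. x \<in> C \<Longrightarrow> x \<in> L \<or> cl x \<in> cl ` (C - {x} \<union> F - L)"
  shows "rel_circuit F C"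
proof -
  have fins: "finite C" "finite F" using assms(1,2) finE by blast+
  have CF: "card (C \<union> F) = card C + card F"
    using card_Un_disjoint[OF fins] assms(1) by blast
  have "indep M (C - {x} \<union> F)" if x: "x \<in> C" for x
  proof -
    have sub: "C - {x} \<union> F \<subseteq> E" using assms(1,2) by blast
    have eq: "insert x (C - {x} \<union> F) = C \<union> F" using x by blast
    have "a (C - {x} \<union> F) = a (C \<union> F)"
      using a_insert_covered[OF sub cov[OF x]] eq by simp
    moreover have "x \<notin> C - {x} \<union> F" using assms(1) x by blast
    then have "card (C \<union> F) = card (C - {x} \<union> F) + 1"
      using card_insert_disjoint[of "C - {x} \<union> F" x] eq finE[OF sub] by simp
    ultimately show ?thesis using sub assms(3,4) CF by (simp add: indep_iff)
  qed
  moreover have "\<not> indep M (C \<union> F)" using assms(3,4) CF by (simp add: indep_iff)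
  ultimately show ?thesis using assms(1) by (simp add: rel_circuit_def)
qed

text \<open>Adding \<open>h\<close> to the unbalanced Hamilton cycle \<open>T\<close> gives
  \<open>n + 1\<close> edges. Removing an \<open>x\<close> other than \<open>h\<close> leaves
  \<open>n\<close> edges, which are independent if they miss a class. They meet all classes only if
  \<open>h\<close> replaces \<open>x\<close> within its class, and \<open>sw\<close> covers that
  case.\<close>

lemma rel_circuit_transversal:
  assumes F: "F \<subseteq> T"
    and T: "T \<subseteq> E" "a T = n" "card T = n" "T \<notin> B"
    and h: "h \<in> E - T"
    and sw: "\<And>x. x \<in> T - F \<Longrightarrow> h \<notin> L \<Longrightarrow> cl x = cl h \<Longrightarrow> insert h (T - {x}) \<notin> B"
  shows "rel_circuit F (insert h (T - F))"
proof -
  have fT: "finite T" using finE[OF T(1)] .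
  have hF: "h \<notin> F" using F h by blast
  have "card (insert h T) = n + 1" using fT h T(3) by simp
  then have "\<not> indep M (insert h T)" using indep_card_le[of "insert h T"] by auto
  moreover have "insert h (T - F) \<union> F = insert h T" using F by blast
  moreover have "indep M (insert h (T - F) - {x} \<union> F)" if x: "x \<in> insert h (T - F)" for x
  proof (cases "x = h")
    case True
    have "insert h (T - F) - {x} \<union> F = T" using F h True by blast
    then show ?thesis using T by (simp add: indep_iff)
  next
    case False
    then have xT: "x \<in> T - F" using x by blast
    have eq: "insert h (T - F) - {x} \<union> F = insert h (T - {x})" using F False xT by blast
    have sub: "T - {x} \<subseteq> E" using T(1) by blast
    have c: "card (T - {x}) = n - 1" using xT T(3) fT by simp
    have ax: "a (T - {x}) = n - 1"
      using partial_transversal_subset[of T "T - {x}"] T c by auto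
    have ch: "card (insert h (T - {x})) = n"
      using fT h c n_ge by simp
    have subI: "insert h (T - {x}) \<subseteq> E" using h T(1) by blast
    show ?thesis
    proof (cases "h \<in> L \<or> cl h \<in> cl ` (T - {x} - L)")
      case True
      then have "a (insert h (T - {x})) = n - 1"
        using a_insert_covered[OF sub True] ax by simp
      then show ?thesis using eq ch subI n_ge by (simp add: indep_iff)
    next
      case new: False
      then have "a (insert h (T - {x})) = n"
        using a_insert_new[OF sub, of h] ax n_ge by simp
      moreover have "cl h \<in> cl ` (E - L)"
        using h new by blast
      then have "cl h \<in> cl ` (T - L)"
        by (simp add: full_classes[OF T(1,2)])
      then obtain y where y: "cl h = cl y" "y \<in> T - L" by (rule imageE)
      then have "y = x" using new by blast
      then have "cl x = cl h" using y(1) by simp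
      then have "insert h (T - {x}) \<notin> B" using sw[OF xT] new by blast
      ultimately show ?thesis using eq ch subI by (simp add: indep_iff)
    qed
  qed
  moreover have "insert h (T - F) \<subseteq> E - F" using T(1) h hF by blast
  ultimately show ?thesis unfolding rel_circuit_def by simp
qed

text \<open>Call an element covered if it is a loop of the graph or its class meets
  \<open>F\<close>. By \<open>cf\<close>, if just one of the two elements is covered, it is
  \<open>e\<close>. Small circuits collect two units of excess from covered elements and parallel
  pairs; where this is impossible, the circuit comes from a Hamilton cycle containing
  \<open>F\<close>.\<close>

lemma rel_circuit_exists_sym:
  assumes F: "F \<subseteq> E" "a F = card F" "card F + 2 \<le> n"
    and e: "e \<in> E - F" and f: "f \<in> E - F" and "e \<noteq> f"
    and cf: "f \<in> L \<or> cl f \<in> cl ` F \<Longrightarrow> e \<in> L \<or> cl e \<in> cl ` F"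
  shows "\<exists>C. rel_circuit F C \<and> e \<in> C \<and> f \<in> C"
proof -
  have FL: "F \<inter> L = {}" "inj_on cl F" using partial_transversalD[OF F(1,2)] by auto
  have FmL: "F - L = F" using FL(1) by blast
  have fF: "finite F" using finE[OF F(1)] .
  \<comment> \<open>The covered \<open>h\<close> and the new parallel pair contribute one unit of
    excess each.\<close>
  have two_parallel: "rel_circuit F {h, x, y}"
    if h: "h \<in> E - F" "h \<in> L \<or> cl h \<in> cl ` F"
      and x: "x \<in> E - L" "cl x \<notin> cl ` F" and y: "y \<in> E - L" "cl y = cl x" "y \<noteq> x" for h x y
  proof (rule rel_circuitI)
    have y': "cl y \<notin> cl ` F" using x(2) y(2) by simp
    have nF: "x \<notin> F" "y \<notin> F" using x(2) y' by blast+
    have hn: "h \<noteq> x" "h \<noteq> y" using h(2) x y(1) y' by blast+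
    show "{h, x, y} \<subseteq> E - F" using h(1) x(1) y(1) nF by blast
    have "a (insert x F) = card F + 1"
      using a_insert_new[of F x] F x FmL by simp
    moreover have sx: "insert x F \<subseteq> E" using F(1) x(1) by blast
    then have "a (insert y (insert x F)) = a (insert x F)"
      using x(1) y(2) by (intro a_insert_covered) auto
    moreover have "insert y (insert x F) \<subseteq> E" using sx y(1) by blast
    then have "a (insert h (insert y (insert x F))) = a (insert y (insert x F))"
      using h(2) FmL by (intro a_insert_covered) auto
    moreover have "{h, x, y} \<union> F = insert h (insert y (insert x F))" by blast
    ultimately have aC: "a ({h, x, y} \<union> F) = card F + 1" by simp
    then show "a ({h, x, y} \<union> F) < n" using F(3) by simp
    show "card {h, x, y} + card F = a ({h, x, y} \<union> F) + 2"
      using aC hn y(3) by simp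
    fix z assume "z \<in> {h, x, y}"
    then consider "z = h" | "z = x" | "z = y" by blast
    then show "z \<in> L \<or> cl z \<in> cl ` ({h, x, y} - {z} \<union> F - L)"
    proof cases
      case 1
      then show ?thesis using h(2) FL(1) by auto
    next
      case 2
      have "y \<in> {h, x, y} - {z} \<union> F - L" using 2 y by blast
      then show ?thesis using 2 y(2) by (metis image_eqI)
    next
      case 3
      have "x \<in> {h, x, y} - {z} \<union> F - L" using 3 x y(3) by blast
      then show ?thesis using 3 y(2) by (metis image_eqI)
    qed
  qed (use F in simp)
  have ext: "\<exists>T. S \<subseteq> T \<and> T \<subseteq> E \<and> a T = n \<and> card T = n" if "S \<subseteq> E" "a S = card S" for S
    by (rule transversal[OF that(1) subset_refl that(2)]) (auto simp: n_eq)
  \<comment> \<open>Two elements of \<open>F\<close> are considered because one may be thin. An edge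
    parallel to the other one lies outside \<open>F\<close>, since \<open>F\<close> is a partial
    transversal.\<close>
  have lt_ex: "\<exists>h. h \<in> E - F \<and> cl h \<in> cl ` F \<and> h \<notin> L" if "2 \<le> card F"
  proof -
    obtain Z where "Z \<subseteq> F" "card Z = 2" 
      using obtain_subset_with_card_n[OF \<open>2 \<le> card F\<close>] by metis
    then obtain x y where "x \<in> F" "y \<in> F" "x \<noteq> y" by (auto simp: card_2_iff)
    then obtain z where z: "z \<in> F" "\<not> thin z" using thin_unique[of x y] by blast
    then have "z \<in> E - L" using F(1) FL(1) by blast
    then obtain h where h: "h \<in> E - L" "h \<noteq> z" "cl h = cl z" using partner z(2) by blast
    then have "h \<notin> F" using FL(2) z(1) by (auto simp: inj_on_def)
    then show ?thesis using h z(1) by (metis Diff_iff image_eqI)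
  qed
  \<comment> \<open>The class of a nonloop \<open>h\<close> already has its edge of \<open>T\<close>
    in \<open>F\<close>, so no element of \<open>T - F\<close> can be exchanged for \<open>h\<close>
    within its class and the condition on exchanges holds vacuously.\<close>
  have lt_transversal: "rel_circuit F (insert h (T - F))"
    if h: "h \<in> E - F" "h \<in> L \<or> cl h \<in> cl ` F"
      and T: "F \<subseteq> T" "T \<subseteq> E" "a T = n" "card T = n" "T \<notin> B" for h T
  proof (rule rel_circuit_transversal[OF T])
    have TL: "T \<inter> L = {}" "inj_on cl T" using partial_transversalD[OF T(2)] T(3,4) by auto
    have ne: "cl x \<noteq> cl h" if x: "x \<in> T - F" and hL: "h \<notin> L" for x
    proof
      assume xh: "cl x = cl h"
      have "cl h \<in> cl ` F" using h(2) hL by blast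
      then obtain y where y: "cl h = cl y" "y \<in> F" by (rule imageE)
      then have "cl x = cl y" using xh by simp
      then have "x = y" using TL(2) x T(1) y(2) unfolding inj_on_def by blast
      then show False using x y(2) by blast
    qed
    have "h \<notin> T"
    proof
      assume "h \<in> T"
      then have "h \<in> T - F" "h \<notin> L" using h(1) TL(1) by blast+
      then show False using ne by blast
    qed
    then show "h \<in> E - T" using h(1) by blast
    show "insert h (T - {x}) \<notin> B" if "x \<in> T - F" "h \<notin> L" "cl x = cl h" for x
      using ne that by blast
  qed
  consider (both) "f \<in> L \<or> cl f \<in> cl ` F" "e \<in> L \<or> cl e \<in> cl ` F"
    | (thick) "f \<notin> L" "cl f \<notin> cl ` F" "e \<in> L \<or> cl e \<in> cl ` F" "\<not> thin f"
    | (thin) "f \<notin> L" "cl f \<notin> cl ` F" "e \<in> L \<or> cl e \<in> cl ` F" "thin f"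
    | (same) "f \<notin> L" "cl f \<notin> cl ` F" "e \<notin> L" "cl e \<notin> cl ` F" "cl e = cl f"
    | (diff) "f \<notin> L" "cl f \<notin> cl ` F" "e \<notin> L" "cl e \<notin> cl ` F" "cl e \<noteq> cl f"
    using cf by blast
  then show ?thesis
  proof cases
    case both
    have "a (insert f F) = a F" using both(1) FmL F(1) by (intro a_insert_covered) auto
    moreover have "a (insert e (insert f F)) = a (insert f F)"
      using both(2) FmL F(1) f by (intro a_insert_covered) auto
    moreover have "{e, f} \<union> F = insert e (insert f F)" by blast
    ultimately have aC: "a ({e, f} \<union> F) = card F" using F(2) by simp
    have "rel_circuit F {e, f}"
    proof (rule rel_circuitI)
      show "{e, f} \<subseteq> E - F" using e f by blast
      show "a ({e, f} \<union> F) < n" using aC F(3) by simp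
      show "card {e, f} + card F = a ({e, f} \<union> F) + 2" using aC \<open>e \<noteq> f\<close> by simp
      show "z \<in> L \<or> cl z \<in> cl ` ({e, f} - {z} \<union> F - L)" if "z \<in> {e, f}" for z
        using that both FL(1) by auto
    qed (use F in simp)
    then show ?thesis by blast
  next
    case thick
    obtain g where "g \<in> E - L" "g \<noteq> f" "cl g = cl f"
      by (rule partner[of f]) (use f thick in auto)
    then have "rel_circuit F {e, f, g}"
      using two_parallel[of e f g] e f thick by blast
    then show ?thesis by blast
  next
    \<comment> \<open>Removing the only edge of a class leaves the excess unchanged, so a relative
      circuit through \<open>f\<close> has to meet all classes. This calls for an unbalanced
      Hamilton cycle through \<open>F\<close> and \<open>f\<close>.\<close>
    case thin
    have sf: "insert f F \<subseteq> E" using f F(1) by blast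
    have af: "a (insert f F) = card F + 1" using a_insert_new[OF F(1), of f] thin(1,2) FmL F(2) by simp
    have cf: "card (insert f F) = card F + 1" using f fF by simp
    obtain T where T: "insert f F \<subseteq> T" "T \<subseteq> E" "a T = n" "card T = n"
      using ext[OF sf] af cf by auto
    \<comment> \<open>If \<open>T\<close> is balanced, its edge \<open>t\<close> in a class missed
      by \<open>insert f F\<close> is exchanged for a parallel edge, which exists because
      \<open>f\<close> is the only thin edge. By \<open>swap\<close> the result is
      unbalanced.\<close>
    have "\<exists>T. insert f F \<subseteq> T \<and> T \<subseteq> E \<and> a T = n \<and> card T = n \<and> T \<notin> B"
    proof (cases "T \<in> B")
      case True
      have "a (insert f F) < n" using af F(3) by simp
      then obtain g where g: "g \<in> E - L" "cl g \<notin> cl ` (insert f F - L)"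
        using miss_one[OF sf] by blast
      then have "cl g \<in> cl ` (T - L)" using full_classes[OF T(2,3)] by blast
      then obtain t where t: "cl g = cl t" "t \<in> T - L" by (rule imageE)
      have tF: "t \<notin> insert f F" using g(2) t by auto
      have "\<not> thin t" using thin_unique[OF thin(4), of t] tF by blast
      then obtain t' where t': "t' \<in> E - L" "t' \<noteq> t" "cl t' = cl t"
        using partner[of t] t(2) T(2) by blast
      have TL: "inj_on cl T" using partial_transversalD[OF T(2)] T(3,4) by auto
      have t'T: "t' \<in> E - T" using t' t(2) TL unfolding inj_on_def by blast
      let ?T = "insert t' (T - {t})"
      have fT: "finite T" using finE[OF T(2)] .
      have c1: "card (T - {t}) = n - 1" using t(2) T(4) by simp
      have c2: "card ?T = n" using t'T fT c1 n_ge by simp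
      have sub: "T - {t} \<subseteq> E" using T(2) by blast
      have a1: "a (T - {t}) = n - 1"
        using partial_transversal_subset[OF T(2), of "T - {t}"] T(3,4) c1 by auto
      have "cl t' \<notin> cl ` (T - {t} - L)"
        using t'(3) t(2) TL unfolding inj_on_def by auto
      then have a2: "a ?T = n"
        using a_insert_new[OF sub, of t'] t'(1) a1 n_ge by simp
      have "?T \<notin> B"
        by (rule swap[OF T(2,3,4) True]) (use t t' t'T in auto)
      then show ?thesis
        using c2 a2 T(1) tF t'T sub by (intro exI[of _ ?T]) auto
    next
      case False
      then show ?thesis using T by blast
    qed
    then obtain T where T: "insert f F \<subseteq> T" "T \<subseteq> E" "a T = n" "card T = n" "T \<notin> B"
      by blast
    have "rel_circuit F (insert e (T - F))"
      by (rule lt_transversal[OF e thin(3) _ T(2-5)]) (use T(1) in blast)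
    then show ?thesis using T(1) f by blast
  next
    case same
    show ?thesis
    proof (cases "2 \<le> card F")
      case True
      obtain h where h: "h \<in> E - F" "cl h \<in> cl ` F" using lt_ex[OF True] by blast
      have "rel_circuit F {h, e, f}"
        by (rule two_parallel) (use h e f same \<open>e \<noteq> f\<close> in simp_all)
      then show ?thesis by blast
    next
      \<comment> \<open>A set \<open>F\<close> with at most one element need not have a covered edge
        outside it. The second unit of excess then comes from a parallel pair in another class; at
        most three classes are met in all.\<close>
      case False
      have se: "insert e F \<subseteq> E" using e F(1) by blast
      have ae: "a (insert e F) = card F + 1" using a_insert_new[OF F(1), of e] same(3,4) FmL F(2) by simp
      then have le: "a (insert e F) + 2 \<le> n" using False n_ge by simp
      obtain g where g: "g \<in> E - L" "cl g \<notin> cl ` (insert e F - L)" "\<not> thin g"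
        by (rule miss_thick[OF se le])
      obtain g' where g': "g' \<in> E - L" "g' \<noteq> g" "cl g' = cl g"
        by (rule partner[OF g(1,3)])
      have "insert e F - L = insert e F" using same(3) FmL by blast
      then have ng: "cl g \<noteq> cl e" "cl g \<notin> cl ` F" using g(2) by simp_all
      have ng': "cl g' \<noteq> cl e" "cl g' \<notin> cl ` F" using ng g'(3) by simp_all
      have ngf: "cl g \<noteq> cl f" "cl g' \<noteq> cl f" using ng(1) ng'(1) same(5) by simp_all
      have nF: "g \<notin> F" "g' \<notin> F" "g \<noteq> e" "g' \<noteq> e" "g \<noteq> f" "g' \<noteq> f"
        using ng ng' ngf by blast+
      let ?C = "{e, f, g, g'}"
      have 1: "a (insert f (insert e F)) = a (insert e F)"
      proof (rule a_insert_covered[OF se])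
        have "e \<in> insert e F - L" using same(3) by blast
        then show "f \<in> L \<or> cl f \<in> cl ` (insert e F - L)"
          using same(5) by (metis image_eqI)
      qed
      have 2: "a (insert g (insert f (insert e F))) = a (insert f (insert e F)) + 1"
      proof (rule a_insert_new)
        show "insert f (insert e F) \<subseteq> E" using se f by blast
        show "cl g \<notin> cl ` (insert f (insert e F) - L)" using ng same(5) by auto
      qed (use g in blast)
      have 3: "a (insert g' (insert g (insert f (insert e F)))) = a (insert g (insert f (insert e F)))"
      proof (rule a_insert_covered)
        show "insert g (insert f (insert e F)) \<subseteq> E" using se f g(1) by blast
        have "g \<in> insert g (insert f (insert e F)) - L" using g(1) by blast
        then show "g' \<in> L \<or> cl g' \<in> cl ` (insert g (insert f (insert e F)) - L)"
          using g'(3) by (metis image_eqI)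
      qed
      have "?C \<union> F = insert g' (insert g (insert f (insert e F)))" by blast
      then have aC: "a (?C \<union> F) = card F + 2" using 1 2 3 ae by simp
      have "rel_circuit F ?C"
      proof (rule rel_circuitI)
        show "?C \<subseteq> E - F" using e f g(1) g'(1) nF by blast
        show "a (?C \<union> F) < n" using aC False n_ge by simp
        have "card ?C = 4" using nF \<open>e \<noteq> f\<close> g'(2) by simp
        then show "card ?C + card F = a (?C \<union> F) + 2" using aC by simp
        fix z assume "z \<in> ?C"
        then consider "z = e" | "z = f" | "z = g" | "z = g'" by blast
        then have "\<exists>w \<in> ?C - {z} \<union> F - L. cl z = cl w"
        proof cases
          case 1
          then show ?thesis using same \<open>e \<noteq> f\<close> by (intro bexI[of _ f]) auto
        next
          case 2
          then show ?thesis using same \<open>e \<noteq> f\<close> by (intro bexI[of _ e]) auto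
        next
          case 3
          then show ?thesis using g g' by (intro bexI[of _ g']) auto
        next
          case 4
          then show ?thesis using g g' by (intro bexI[of _ g]) auto
        qed
        then show "z \<in> L \<or> cl z \<in> cl ` (?C - {z} \<union> F - L)" by blast
      qed (use F in simp)
      then show ?thesis by blast
    qed
  next
    case diff
    let ?S = "insert e (insert f F)"
    have sf: "insert f F \<subseteq> E" and S: "?S \<subseteq> E" using e f F(1) by blast+
    have "a (insert f F) = card F + 1"
      using a_insert_new[OF F(1), of f] diff(1,2) FmL F(2) by simp
    moreover have "cl e \<notin> cl ` (insert f F - L)" using diff by auto
    ultimately have aS: "a ?S = card F + 2"
      using a_insert_new[OF sf, of e] diff(3) by simp
    have cS: "card ?S = card F + 2" using e f \<open>e \<noteq> f\<close> fF by simp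
    obtain T where T: "?S \<subseteq> T" "T \<subseteq> E" "a T = n" "card T = n"
      using ext[OF S] aS cS by auto
    \<comment> \<open>A balanced Hamilton cycle through \<open>?S\<close> yields a relative circuit
      at once. If there is none, every exchange that keeps \<open>?S\<close> stays
      unbalanced.\<close>
    show ?thesis
    proof (cases "\<exists>T. ?S \<subseteq> T \<and> T \<subseteq> E \<and> a T = n \<and> card T = n \<and> T \<in> B")
      case True
      then obtain T where T: "?S \<subseteq> T" "T \<subseteq> E" "a T = n" "card T = n" "T \<in> B" by blast
      have "rel_circuit F (T - F)"
        unfolding rel_circuit_def
      proof (intro conjI ballI)
        have "T - F \<union> F = T" using T(1) by blast
        then show "\<not> indep M (T - F \<union> F)" using T(3,5) by (simp add: indep_iff)
        show "T - F \<subseteq> E - F" using T(2) by blast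
        fix x assume x: "x \<in> T - F"
        then have eq: "T - F - {x} \<union> F = T - {x}" using T(1) by blast
        have "a (T - {x}) = card (T - {x})"
          using partial_transversal_subset[OF T(2), of "T - {x}"] T(3,4) by auto
        moreover have "card (T - {x}) = n - 1" using x T(4) by simp
        ultimately show "indep M (T - F - {x} \<union> F)"
          unfolding eq using T(2) n_ge by (auto simp: indep_iff)
      qed
      then show ?thesis using T(1) e f by blast
    next
      case False
      have TB: "T \<notin> B" using False T by blast
      show ?thesis
      proof (cases "2 \<le> card F")
        case True
        obtain h where h: "h \<in> E - F" "cl h \<in> cl ` F" using lt_ex[OF True] by blast
        have "rel_circuit F (insert h (T - F))"
          by (rule lt_transversal[OF h(1) _ _ T(2-4) TB]) (use T(1) h(2) in blast)+
        then show ?thesis using T(1) e f by blast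
      next
        \<comment> \<open>No covered edge need exist, so \<open>h\<close> is taken from a non-thin
          class missed by \<open>?S\<close>. Exchanging the edge \<open>t\<close> of
          \<open>T\<close> in that class for \<open>h\<close> gives another Hamilton cycle through
          \<open>?S\<close>, unbalanced in the present case.\<close>
        case few: False
        then have le: "a ?S + 2 \<le> n" using aS n_ge by simp
        obtain g where g: "g \<in> E - L" "cl g \<notin> cl ` (?S - L)" "\<not> thin g"
          by (rule miss_thick[OF S le])
        then have "cl g \<in> cl ` (T - L)" using full_classes[OF T(2,3)] by blast
        then obtain t where t: "cl g = cl t" "t \<in> T - L" by (rule imageE)
        have tS: "t \<notin> ?S" using g(2) t by auto
        have TL: "inj_on cl T" using partial_transversalD[OF T(2)] T(3,4) by auto
        obtain h where h: "h \<in> E - L" "h \<noteq> t" "cl h = cl t"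
        proof (cases "g = t")
          case True
          obtain g' where "g' \<in> E - L" "g' \<noteq> g" "cl g' = cl g"
            by (rule partner[OF g(1,3)])
          then show ?thesis using True by (intro that[of g']) simp_all
        next
          case False
          then show ?thesis using g(1) t(1) by (intro that[of g]) simp_all
        qed
        have hT: "h \<in> E - T" using h t(2) TL unfolding inj_on_def by blast
        have "rel_circuit F (insert h (T - F))"
        proof (rule rel_circuit_transversal[OF _ T(2-4) TB hT])
          show "F \<subseteq> T" using T(1) by blast
          fix x assume x: "x \<in> T - F" "cl x = cl h"
          have "x = t"
            by (rule inj_onD[OF TL]) (use x h(3) t(2) in simp_all)
          let ?T = "insert h (T - {x})"
          have sub: "T - {x} \<subseteq> E" using T(2) by blast
          have c1: "card (T - {x}) = n - 1" using x(1) T(4) by simp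
          have c2: "card ?T = n" using hT c1 n_ge finE[OF sub] by simp
          have a1: "a (T - {x}) = n - 1"
            using partial_transversal_subset[OF T(2), of "T - {x}"] T(3,4) c1 by auto
          have "cl h \<notin> cl ` (T - {x} - L)"
          proof
            assume "cl h \<in> cl ` (T - {x} - L)"
            then obtain y where y: "cl h = cl y" "y \<in> T - {x} - L" by (rule imageE)
            have "x = y"
              by (rule inj_onD[OF TL]) (use x y in simp_all)
            then show False using y(2) by blast
          qed
          then have a2: "a ?T = n"
            using a_insert_new[OF sub, of h] h(1) a1 n_ge by simp
          have "?S \<subseteq> ?T" using T(1) tS \<open>x = t\<close> by blast
          moreover have "?T \<subseteq> E" using sub h(1) by blast
          ultimately show "?T \<notin> B" using False c2 a2 by blast
        qed
        then show ?thesis using T(1) e f by blast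
      qed
    qed
  qed
qed

end

section \<open>Connectedness of the contractions\<close>

lemma basis_exists:
  assumes "finite (ground M)" "F \<subseteq> ground M" "indep M {}"
  shows "\<exists>A. basis_of M F A"
proof -
  have fF: "finite F" using assms(1,2) finite_subset by blast
  obtain A where A: "A \<subseteq> F" "indep M A" "card A = rank M F"
    by (rule obtain_rank[OF fF assms(3)])
  have fA: "finite A" using finite_subset[OF A(1) fF] .
  have "\<not> indep M (insert x A)" if x: "x \<in> F - A" for x
  proof
    assume "indep M (insert x A)"
    then have "card (insert x A) \<le> rank M F"
      using card_le_rank[OF fF, of "insert x A" M] A(1) x by simp
    then show False using x fA A(3) by simp
  qed
  then show ?thesis using A unfolding basis_of_def by blast
qed

context thick_cyclic_lift
begin

lemma rel_circuit_exists:
  assumes "F \<subseteq> E" "a F = card F" "card F + 2 \<le> n" "e \<in> E - F" "f \<in> E - F" "e \<noteq> f"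
  shows "\<exists>C. rel_circuit F C \<and> e \<in> C \<and> f \<in> C"
proof (cases "f \<in> L \<or> cl f \<in> cl ` F \<longrightarrow> e \<in> L \<or> cl e \<in> cl ` F")
  case True
  then show ?thesis by (intro rel_circuit_exists_sym assms) blast
next
  case False
  then have "\<exists>C. rel_circuit F C \<and> f \<in> C \<and> e \<in> C"
    by (intro rel_circuit_exists_sym assms assms(6)[symmetric]) blast
  then show ?thesis by blast
qed

lemma ground_contract: "ground (contract M F) = E - F"
  by (simp add: contract_def)

lemma indep_contract:
  "indep (contract M F) I \<longleftrightarrow> I \<subseteq> E - F \<and> (\<exists>A. basis_of M F A \<and> indep M (I \<union> A))"
  by (simp add: contract_def)

text \<open>By heredity an independent \<open>F\<close> is its own only basis, which removes the
  quantifier over bases from \<open>contract\<close>.\<close>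

lemma indep_contract_indep:
  assumes "indep M F"
  shows "indep (contract M F) I \<longleftrightarrow> I \<subseteq> E - F \<and> indep M (I \<union> F)"
proof -
  have "basis_of M F A \<longleftrightarrow> A = F" for A
  proof
    assume A: "basis_of M F A"
    have False if x: "x \<in> F - A" for x
    proof -
      have "insert x A \<subseteq> F" using A x unfolding basis_of_def by blast
      then have "indep M (insert x A)" using indep_mono[OF assms] by blast
      then show False using A x unfolding basis_of_def by blast
    qed
    then show "A = F" using A unfolding basis_of_def by blast
  next
    assume "A = F"
    then show "basis_of M F A" using assms by (simp add: basis_of_def)
  qed
  then show ?thesis by (simp add: indep_contract)
qed

lemma circuit_contract:
  assumes F: "indep M F" and C: "rel_circuit F C"
  shows "circuit (contract M F) C"
  unfolding circuit_def ground_contract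
proof (intro conjI allI impI)
  show CE: "C \<subseteq> E - F" using C by (simp add: rel_circuit_def)
  show "\<not> indep (contract M F) C"
    using C by (simp add: indep_contract_indep[OF F] rel_circuit_def)
  fix D assume D: "D \<subset> C"
  then obtain x where x: "x \<in> C" "x \<notin> D" by blast
  have "indep M (C - {x} \<union> F)" using C x(1) by (simp add: rel_circuit_def)
  moreover have "D \<union> F \<subseteq> C - {x} \<union> F" using D x(2) by blast
  ultimately have "indep M (D \<union> F)" by (rule indep_mono)
  then show "indep (contract M F) D"
    using D CE by (auto simp: indep_contract_indep[OF F])
qed

lemma connected_contract_small:
  assumes "F \<subseteq> E" "a F = card F" "card F + 2 \<le> n"
  shows "connected_matroid (contract M F)"
  unfolding connected_matroid_def ground_contract
proof (intro ballI impI)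
  fix e f assume ef: "e \<in> E - F" "f \<in> E - F" "e \<noteq> f"
  then obtain C where C: "rel_circuit F C" "e \<in> C" "f \<in> C"
    using rel_circuit_exists[OF assms] by blast
  have "indep M F" using assms by (simp add: indep_iff)
  then show "\<exists>C. circuit (contract M F) C \<and> e \<in> C \<and> f \<in> C"
    using C circuit_contract by blast
qed

lemma connected: "connected_matroid M"
  unfolding connected_matroid_def
proof (intro ballI impI)
  fix e f assume ef: "e \<in> E" "f \<in> E" "e \<noteq> f"
  then obtain C where C: "rel_circuit {} C" "e \<in> C" "f \<in> C"
    using rel_circuit_exists[of "{}" e f] n_ge by auto
  have "circuit M C"
    unfolding circuit_def
  proof (intro conjI allI impI)
    show "C \<subseteq> E" "\<not> indep M C" using C(1) by (auto simp: rel_circuit_def)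
    fix D assume "D \<subset> C"
    then obtain x where x: "x \<in> C" "D \<subseteq> C - {x}" by blast
    have "indep M (C - {x})" using C(1) x(1) by (simp add: rel_circuit_def)
    then show "indep M D" using x(2) by (rule indep_mono)
  qed
  then show "\<exists>C. circuit M C \<and> e \<in> C \<and> f \<in> C" using C by blast
qed

lemma flat_rank:
  assumes "flat M F" "e \<in> E - F"
  shows "rank M F < rank M (insert e F)"
proof -
  have FE: "F \<subseteq> E" and cl: "closure M F = F" using assms(1) by (auto simp: flat_def)
  have "e \<notin> closure M F" using assms(2) cl by blast
  then have "rank M (insert e F) \<noteq> rank M F" using assms(2) by (simp add: closure_def)
  moreover have "rank M F \<le> rank M (insert e F)"
    by (rule rank_mono) (use finE[OF FE] indep_empty in auto)
  ultimately show ?thesis by simp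
qed

text \<open>The assumptions say that the contraction has rank one and no loops.\<close>

lemma connected_contract_rank_one:
  assumes FE: "F \<subseteq> E"
    and basis: "\<And>A. basis_of M F A \<Longrightarrow> card A = n - 1"
    and nonloop: "\<And>e. e \<in> E - F \<Longrightarrow> \<exists>A. basis_of M F A \<and> indep M (insert e A)"
  shows "connected_matroid (contract M F)"
  unfolding connected_matroid_def ground_contract
proof (intro ballI impI)
  fix e f assume ef: "e \<in> E - F" "f \<in> E - F" "e \<noteq> f"
  have single: "indep (contract M F) D" if x: "x \<in> E - F" and D: "D \<subseteq> {x}" for x D
  proof -
    obtain A where A: "basis_of M F A" "indep M (insert x A)" using nonloop[OF x] by blast
    have "D \<union> A \<subseteq> insert x A" using D by blast
    then have "indep M (D \<union> A)" by (rule indep_mono[OF A(2)])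
    moreover have "D \<subseteq> E - F" using D x by blast
    ultimately show ?thesis using A(1) unfolding indep_contract by blast
  qed
  have "\<not> indep (contract M F) {e, f}"
  proof
    assume "indep (contract M F) {e, f}"
    then obtain A where A: "basis_of M F A" "indep M ({e, f} \<union> A)"
      unfolding indep_contract by blast
    have AF: "A \<subseteq> F" using A(1) by (simp add: basis_of_def)
    then have "finite A" using finE FE by blast
    moreover have "e \<notin> A" "f \<notin> A" using AF ef by blast+
    ultimately have "card ({e, f} \<union> A) = n + 1" using basis[OF A(1)] ef(3) n_ge by simp
    then show False using indep_card_le[OF A(2)] by simp
  qed
  moreover have "indep (contract M F) D" if D: "D \<subset> {e, f}" for D
  proof -
    consider "D \<subseteq> {e}" | "D \<subseteq> {f}" using D by blast
    then show ?thesis using single[OF ef(1)] single[OF ef(2)] by cases blast+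
  qed
  ultimately have "circuit (contract M F) {e, f}"
    unfolding circuit_def ground_contract using ef by blast
  then show "\<exists>C. circuit (contract M F) C \<and> e \<in> C \<and> f \<in> C" by blast
qed

text \<open>The bases of \<open>F\<close> are the sets \<open>F - {t}\<close>. For \<open>e\<close>
  outside \<open>F\<close>, choosing \<open>t\<close> outside the class of \<open>e\<close> makes
  \<open>insert e (F - {t})\<close> a set of \<open>n\<close> edges that misses the class of
  \<open>t\<close>, hence independent.\<close>

lemma connected_contract_balanced_Hamilton:
  assumes F: "F \<subseteq> E" "a F = n" "card F = n" "F \<in> B"
  shows "connected_matroid (contract M F)"
proof (rule connected_contract_rank_one[OF F(1)])
  have fF: "finite F" using finE[OF F(1)] .
  have FL: "F \<inter> L = {}" "inj_on cl F" using partial_transversalD[OF F(1)] F(2,3) by auto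
  have dep: "\<not> indep M F" using F(2,4) by (simp add: indep_iff)
  have cc: "card (F - {t}) = n - 1" if "t \<in> F" for t using that F(3) by simp
  have aa: "a (F - {t}) = n - 1" if "t \<in> F" for t
    using partial_transversal_subset[OF F(1), of "F - {t}"] F(2,3) cc[OF that] by auto
  have ind: "indep M (F - {t})" if "t \<in> F" for t
    using cc[OF that] aa[OF that] F(1) n_ge by (auto simp: indep_iff)
  show "card A = n - 1" if A: "basis_of M F A" for A
  proof -
    have AF: "A \<subseteq> F" "indep M A" using A by (auto simp: basis_of_def)
    then have "A \<noteq> F" using dep by auto
    then obtain t where t: "t \<in> F - A" using AF(1) by blast
    have "insert t A = F"
    proof (rule ccontr)
      assume "insert t A \<noteq> F"
      then obtain s where s: "s \<in> F" "insert t A \<subseteq> F - {s}" using t AF(1) by blast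
      have "indep M (insert t A)" by (rule indep_mono[OF ind[OF s(1)] s(2)])
      then show False using A t unfolding basis_of_def by blast
    qed
    then have "A = F - {t}" using t by blast
    then show ?thesis using cc t by blast
  qed
  fix e assume e: "e \<in> E - F"
  have "\<exists>t\<in>F. cl t \<noteq> cl e"
  proof (rule ccontr)
    assume "\<not> ?thesis"
    then have "cl ` F \<subseteq> {cl e}" by blast
    then have "card (cl ` F) \<le> 1" using card_mono[of "{cl e}"] by fastforce
    then show False using card_image[OF FL(2)] F(3) n_ge by simp
  qed
  then obtain t where t: "t \<in> F" "cl t \<noteq> cl e" by blast
  have sub: "F - {t} \<subseteq> E" using F(1) by blast
  have "e \<in> L \<or> cl e \<in> cl ` (F - {t} - L)"
  proof (cases "e \<in> L")
    case False
    then have "cl e \<in> cl ` (E - L)" using e by blast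
    then have "cl e \<in> cl ` (F - L)" by (simp add: full_classes[OF F(1,2)])
    then obtain y where y: "cl e = cl y" "y \<in> F - L" by (rule imageE)
    then have "y \<in> F - {t} - L" using t(2) by auto
    then show ?thesis using y(1) by blast
  qed simp
  then have "a (insert e (F - {t})) = n - 1"
    using a_insert_covered[OF sub] aa[OF t(1)] by simp
  moreover have "card (insert e (F - {t})) = n"
    using e fF cc[OF t(1)] n_ge by simp
  moreover have "insert e (F - {t}) \<subseteq> E" using e sub by blast
  ultimately have "indep M (insert e (F - {t}))" using n_ge by (simp add: indep_iff)
  moreover have "basis_of M F (F - {t})"
    unfolding basis_of_def
  proof (intro conjI ballI)
    fix x assume "x \<in> F - (F - {t})"
    then have "insert x (F - {t}) = F" by blast
    then show "\<not> indep M (insert x (F - {t}))" using dep by simp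
  qed (use ind[OF t(1)] in auto)
  ultimately show "\<exists>A. basis_of M F A \<and> indep M (insert e A)" by blast
qed

text \<open>An edge that completes \<open>F\<close> to a balanced Hamilton cycle would be a loop of
  the contraction, but it lies in the closure of \<open>F\<close>; this is where flatness
  enters.\<close>

lemma connected_contract_hyperplane:
  assumes flat: "flat M F" and F: "a F = card F" "card F = n - 1"
  shows "connected_matroid (contract M F)"
proof -
  have FE: "F \<subseteq> E" using flat by (simp add: flat_def)
  have fF: "finite F" using finE[OF FE] .
  have ind: "indep M F" using FE F n_ge by (simp add: indep_iff)
  have uniq: "A = F" if A: "basis_of M F A" for A
  proof (rule ccontr)
    assume "A \<noteq> F"
    then obtain x where x: "x \<in> F - A" using A unfolding basis_of_def by blast
    then have "insert x A \<subseteq> F" using A unfolding basis_of_def by blast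
    then show False using indep_mono[OF ind] A x unfolding basis_of_def by blast
  qed
  have bas: "basis_of M F F" using ind by (simp add: basis_of_def)
  show ?thesis
  proof (rule connected_contract_rank_one[OF FE])
    show "card A = n - 1" if "basis_of M F A" for A using uniq[OF that] F(2) by simp
    fix e assume e: "e \<in> E - F"
    have "indep M (insert e F)"
    proof (rule ccontr)
      assume dep: "\<not> indep M (insert e F)"
      have "rank M (insert e F) < card (insert e F)"
        by (rule rank_less_card[OF _ indep_empty dep]) (use fF in simp)
      moreover have "card F \<le> rank M F" by (rule card_le_rank[OF fF subset_refl ind])
      ultimately show False using flat_rank[OF flat e] e fF by simp
    qed
    then show "\<exists>A. basis_of M F A \<and> indep M (insert e A)" using bas by blast
  qed
qed

text \<open>A non-spanning flat containing an unbalanced cycle is a union of parallel classes together with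
  all loops. In the contraction the remaining classes form a cycle graph with balanced Hamilton cycles
  only.\<close>

lemma connected_contract_unbalanced:
  assumes flat: "flat M F" and F: "a F + 1 < n" "a F < card F"
  shows "connected_matroid (contract M F)"
proof -
  have FE: "F \<subseteq> E" using flat by (simp add: flat_def)
  have fF: "finite F" using finE[OF FE] .
  have rF: "rank M F = a F + 1" using rank_eq[OF FE] F by simp
  \<comment> \<open>Since \<open>F\<close> already has positive excess, a further loop of the graph
    or edge of a met class would not raise the rank, so the flat contains it.\<close>
  have out: "e \<notin> L" "cl e \<notin> cl ` (F - L)" if e: "e \<in> E - F" for e
  proof -
    have "\<not> (e \<in> L \<or> cl e \<in> cl ` (F - L))"
    proof
      assume "e \<in> L \<or> cl e \<in> cl ` (F - L)"
      then have "a (insert e F) = a F" by (rule a_insert_covered[OF FE])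
      moreover have "insert e F \<subseteq> E" using FE e by blast
      moreover have "card (insert e F) = card F + 1" using e fF by simp
      ultimately have "rank M (insert e F) = a F + 1" using rank_eq[of "insert e F"] F by simp
      then show False using flat_rank[OF flat e] rF by simp
    qed
    then show "e \<notin> L" "cl e \<notin> cl ` (F - L)" by auto
  qed
  have bas: "a A = a F" "card A = a F + 1" if A: "basis_of M F A" for A
  proof -
    have AF: "A \<subseteq> F" and iA: "indep M A" and max: "\<And>x. x \<in> F - A \<Longrightarrow> \<not> indep M (insert x A)"
      using A by (auto simp: basis_of_def)
    have AE: "A \<subseteq> E" and fA: "finite A" using AF FE finE by blast+
    have aAF: "a A \<le> a F" by (rule num_classes_mono[OF AF fF])
    have cA: "card A \<le> a A + 1" using iA aAF F(1) by (auto simp: indep_iff)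
    have grow: "\<not> (card (insert x A) \<le> a (insert x A) + 1)" if x: "x \<in> F - A" for x
    proof
      assume *: "card (insert x A) \<le> a (insert x A) + 1"
      have sub: "insert x A \<subseteq> F" using x AF by blast
      then have "a (insert x A) \<le> a F" by (rule num_classes_mono[OF _ fF])
      then have "indep M (insert x A)" using * sub FE F(1) by (auto simp: indep_iff)
      then show False using max[OF x] by blast
    qed
    show eq: "a A = a F"
    proof (rule ccontr)
      assume "a A \<noteq> a F"
      then have "\<not> cl ` (F - L) \<subseteq> cl ` (A - L)"
        using card_mono[of "cl ` (A - L)" "cl ` (F - L)"] fA aAF by (auto simp: num_classes_def)
      then obtain x where x: "x \<in> F - L" "cl x \<notin> cl ` (A - L)" by blast
      then have xA: "x \<notin> A" by blast
      have "a (insert x A) = a A + 1" using a_insert_new[OF AE] x by blast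
      then show False using grow[of x] x(1) xA fA cA by simp
    qed
    have "\<not> card A \<le> a A"
    proof
      assume le: "card A \<le> a A"
      then have "A \<noteq> F" using eq F(2) by auto
      then obtain x where x: "x \<in> F - A" using AF by blast
      have "a A \<le> a (insert x A)" by (rule num_classes_mono) (use fA in auto)
      then show False using grow[OF x] x fA le by simp
    qed
    then show "card A = a F + 1" using cA eq by simp
  qed
  have union: "a (I \<union> A) = a I + a F \<and> card (I \<union> A) = card I + a F + 1"
    if I: "I \<subseteq> E - F" and A: "basis_of M F A" for I A
  proof -
    have AF: "A \<subseteq> F" using A by (simp add: basis_of_def)
    have fins: "finite I" "finite A" using I AF FE finE by blast+
    have "cl ` (I - L) \<inter> cl ` (A - L) = {}"
    proof (rule ccontr)
      assume "\<not> ?thesis"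
      then obtain c where c: "c \<in> cl ` (I - L)" "c \<in> cl ` (A - L)" by blast
      obtain x where x: "c = cl x" "x \<in> I - L" using c(1) by (rule imageE)
      obtain y where y: "c = cl y" "y \<in> A - L" using c(2) by (rule imageE)
      have "cl x \<in> cl ` (F - L)"
        by (rule image_eqI[of _ _ y]) (use x y AF in auto)
      moreover have "x \<in> E - F" using x(2) I by blast
      ultimately show False using out(2) by blast
    qed
    then have "a (I \<union> A) = a I + a A"
      unfolding num_classes_def Un_Diff image_Un
      by (rule card_Un_disjoint[rotated 2]) (simp_all add: fins)
    moreover have "card (I \<union> A) = card I + card A"
      by (rule card_Un_disjoint[OF fins]) (use I AF in blast)
    ultimately show ?thesis using bas[OF A] by simp
  qed
  obtain A0 where A0: "basis_of M F A0" using basis_exists[OF fin FE indep_empty] by blast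
  have A0E: "A0 \<subseteq> E" using A0 FE by (auto simp: basis_of_def)
  \<comment> \<open>This is the cycle matroid of the fat cycle on the \<open>n - a F\<close>
    remaining classes. A basis of \<open>F\<close> has excess 1, so \<open>I\<close> may add none;
    and if \<open>I\<close> met all remaining classes, there would be \<open>n + 1\<close> edges in
    all.\<close>
  have con: "indep (contract M F) I \<longleftrightarrow> card I = a I \<and> a I + a F < n" if I: "I \<subseteq> E - F" for I
  proof -
    have IE: "I \<subseteq> E" using I by blast
    have "indep M (I \<union> A) \<longleftrightarrow> card I = a I \<and> a I + a F < n" if A: "basis_of M F A" for A
    proof -
      have sub: "I \<union> A \<subseteq> E" using IE A FE by (auto simp: basis_of_def)
      show ?thesis
        using union[OF I A] a_le_card[OF IE] sub a_le_n[OF sub] unfolding indep_iff by auto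
    qed
    then show ?thesis using A0 I unfolding indep_contract by blast
  qed
  show ?thesis
    unfolding connected_matroid_def ground_contract
  proof (intro ballI impI)
    fix e f assume ef: "e \<in> E - F" "f \<in> E - F" "e \<noteq> f"
    have eL: "e \<notin> L" "f \<notin> L" using out(1) ef by blast+
    show "\<exists>C. circuit (contract M F) C \<and> e \<in> C \<and> f \<in> C"
    proof (cases "cl e = cl f")
      case True
      have sub: "{e, f} \<subseteq> E - F" using ef by blast
      have one: "a {x} = 1" if "x = e \<or> x = f" for x
        using a_insert_new[of "{}" x] that eL by auto
      have "a {e, f} \<noteq> card {e, f}"
        using a_insert_covered[of "{f}" e] one[of f] ef eL True by simp
      then have "\<not> indep (contract M F) {e, f}" using con[OF sub] by simp
      moreover have "indep (contract M F) D" if D: "D \<subset> {e, f}" for D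
      proof -
        have DE: "D \<subseteq> E - F" using D sub by blast
        consider "D = {}" | "D = {e}" | "D = {f}" using D by blast
        then have "card D = a D \<and> a D \<le> 1" using one by cases auto
        then show ?thesis using con[OF DE] F(1) by simp
      qed
      ultimately have "circuit (contract M F) {e, f}"
        unfolding circuit_def ground_contract using sub by blast
      then show ?thesis by blast
    next
      case False
      have S: "{e, f} \<subseteq> E - F" and fE: "{f} \<subseteq> E" using ef by blast+
      have "a {f} = 1" using a_insert_new[of "{}" f] eL by simp
      moreover have "cl e \<notin> cl ` ({f} - L)" using False by auto
      ultimately have "a {e, f} = 2"
        using a_insert_new[OF fE, of e] eL by simp
      then have aS: "a {e, f} = card {e, f}" using ef(3) by simp
      have EF: "E - F \<subseteq> E" by blast
      obtain T where T: "{e, f} \<subseteq> T" "T \<subseteq> E - F" "a T = card T" "card T = a (E - F)"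
        by (rule transversal[OF S EF aS])
      have TE: "T \<subseteq> E" using T(2) by blast
      have "n \<le> a F + a (E - F)"
        using num_classes_Un_le[of cl L F "E - F"] FE n_eq by (simp add: Un_absorb1)
      then have "\<not> indep (contract M F) T" using con[OF T(2)] T(4) T(3) by simp
      moreover have "indep (contract M F) D" if D: "D \<subset> T" for D
      proof -
        have DE: "D \<subseteq> E - F" using D T(2) by blast
        have "a D = card D" using partial_transversal_subset[OF TE T(3)] D by blast
        moreover have "card D < card T" using psubset_card_mono[OF finE[OF TE] D] .
        moreover have "a (T \<union> A0) \<le> n" by (rule a_le_n) (use TE A0E in blast)
        then have "a T + a F \<le> n" using union[OF T(2) A0] by simp
        ultimately show ?thesis using con[OF DE] T(3) by simp
      qed
      ultimately have "circuit (contract M F) T"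
        unfolding circuit_def ground_contract using T(2) by blast
      then show ?thesis using T(1) by blast
    qed
  qed
qed

lemma unbreakable_lift: "unbreakable M"
  unfolding unbreakable_def
proof (intro conjI allI impI connected)
  fix F assume flat: "flat M F"
  then have FE: "F \<subseteq> E" by (simp add: flat_def)
  have le: "a F \<le> n" "a F \<le> card F" using a_le_n[OF FE] a_le_card[OF FE] .
  show "connected_matroid (contract M F)"
  proof (cases "rank M F = n")
    case True
    have "E - F = {}"
    proof (rule ccontr)
      assume "E - F \<noteq> {}"
      then obtain e where e: "e \<in> E - F" by blast
      have "rank M (insert e F) \<le> rank M E"
        by (rule rank_mono[OF fin _ indep_empty]) (use e FE in blast)
      then show False using flat_rank[OF flat e] True rank_ground by simp
    qed
    then show ?thesis unfolding connected_matroid_def ground_contract by blast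
  next
    case False
    \<comment> \<open>By \<open>rank_eq\<close>, a set of rank other than \<open>n\<close> that
      meets all classes is a balanced Hamilton cycle, and one that misses a class with positive
      excess has rank \<open>a F + 1\<close>, so it misses at least two classes.\<close>
    then consider (bal) "a F = n" "card F = n" "F \<in> B" | (unbal) "a F + 1 < n" "a F < card F"
      | (transversal) "a F = card F" "card F < n"
      using rank_eq[OF FE] le by (cases "a F = n"; cases "a F = card F") (auto split: if_splits)
    then show ?thesis
    proof cases
      case bal
      then show ?thesis by (intro connected_contract_balanced_Hamilton FE)
    next
      case unbal
      then show ?thesis by (rule connected_contract_unbalanced[OF flat])
    next
      case transversal
      show ?thesis
      proof (cases "card F = n - 1")
        case True
        then show ?thesis by (rule connected_contract_hyperplane[OF flat transversal(1)])
      next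
        case False
        then have "card F + 2 \<le> n" using transversal(2) by simp
        then show ?thesis by (rule connected_contract_small[OF FE transversal(1)])
      qed
    qed
  qed
qed

end

section \<open>Cycles and thetas in fat cycles\<close>

lemma finite_vertices_of:
  assumes "multigraph G" "X \<subseteq> edges G"
  shows "finite (vertices_of G X)"
proof -
  have "vertices_of G X \<subseteq> verts G"
    using assms unfolding multigraph_def vertices_of_def by blast
  then show ?thesis using assms(1) finite_subset unfolding multigraph_def by blast
qed

lemma UN_set_nth: "(\<Union>e\<in>set es. f e) = (\<Union>i<length es. f (es ! i))"
proof -
  have "set es = (!) es ` {..<length es}"
    by (metis atLeast_upt image_set map_nth)
  then show ?thesis by simp
qed

lemma set_conv_UN_nth: "set xs = (\<Union>i<length xs. {xs ! i})"
  using UN_set_nth[of "\<lambda>x. {x}" xs] by simp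

lemma is_cycleD:
  assumes "is_cycle G C"
  shows "C \<subseteq> edges G" "C \<noteq> {}" "finite C" "card (vertices_of G C) = card C"
proof -
  obtain vs es where C: "es \<noteq> []" "length vs = length es" "distinct vs" "distinct es"
    "set es \<subseteq> edges G" "C = set es"
    "\<And>i. i < length es \<Longrightarrow> ends G (es ! i) = {vs ! i, vs ! (Suc i mod length es)}"
    using assms unfolding is_cycle_def by blast
  show "C \<subseteq> edges G" "C \<noteq> {}" "finite C" using C(1,5,6) by simp_all
  have "vertices_of G C = (\<Union>i<length es. ends G (es ! i))"
    unfolding vertices_of_def C(6) by (rule UN_set_nth)
  also have "\<dots> = (\<Union>i<length es. {vs ! i, vs ! (Suc i mod length es)})"
    using C(7) by simp
  also have "\<dots> = set vs"
  proof
    have pos: "0 < length es" using C(1) by simp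
    then show "(\<Union>i<length es. {vs ! i, vs ! (Suc i mod length es)}) \<subseteq> set vs"
      using C(2) by auto
    show "set vs \<subseteq> (\<Union>i<length es. {vs ! i, vs ! (Suc i mod length es)})"
      unfolding set_conv_UN_nth[of vs] C(2) by (rule UN_mono) auto
  qed
  finally show "card (vertices_of G C) = card C"
    using C(2-4,6) by (simp add: distinct_card)
qed

lemma Suc_mod_cases:
  assumes "i < (m::nat)"
  shows "Suc i mod m = Suc i \<or> Suc i = m \<and> Suc i mod m = 0"
proof (cases "Suc i = m")
  case False
  then have "Suc i < m" using assms by simp
  then show ?thesis by simp
qed simp

lemma Suc_mod_neq:
  assumes "i < m" "2 \<le> (m::nat)"
  shows "Suc i mod m \<noteq> i"
  using Suc_mod_cases[OF assms(1)] assms(2) by (elim disjE conjE) linarith+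

text \<open>For different \<open>i\<close> and \<open>j\<close> each would be the cyclic successor
  of the other, which happens only for \<open>m = 2\<close>.\<close>

lemma cyclic_pair_inj:
  assumes "i < m" "j < m" "3 \<le> (m::nat)" "{i, Suc i mod m} = {j, Suc j mod m}"
  shows "i = j"
proof (rule ccontr)
  assume "i \<noteq> j"
  then have "i = Suc j mod m" "j = Suc i mod m" 
    using assms(4) unfolding doubleton_eq_iff by metis+
  then show False
    using Suc_mod_cases[OF assms(1)] Suc_mod_cases[OF assms(2)] assms(3)
    by (elim disjE conjE) linarith+
qed

lemma distinct_pair_inj:
  assumes "distinct vs" "i < length vs" "j < length vs" "3 \<le> length vs"
    "{vs ! i, vs ! (Suc i mod length vs)} = {vs ! j, vs ! (Suc j mod length vs)}"
  shows "i = j"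
proof -
  have pos: "Suc k mod length vs < length vs" for k using assms(4) by (intro mod_less_divisor) auto
  have "{i, Suc i mod length vs} = {j, Suc j mod length vs}"
    using assms(5) nth_eq_iff_index_eq[OF assms(1)] assms(2,3) pos[of i] pos[of j]
    by (simp add: doubleton_eq_iff)
  then show ?thesis using cyclic_pair_inj assms(2-4) by blast
qed

lemma is_cycle_long:
  assumes "is_cycle G C" "3 \<le> card C"
  shows "inj_on (ends G) C" "\<And>e. e \<in> C \<Longrightarrow> \<not> is_loop G e"
proof -
  obtain vs es where C: "length vs = length es" "distinct vs" "distinct es" "C = set es"
    "\<And>i. i < length es \<Longrightarrow> ends G (es ! i) = {vs ! i, vs ! (Suc i mod length es)}"
    using assms(1) unfolding is_cycle_def by blast
  have len: "3 \<le> length vs" using assms(2) C(1,3,4) by (simp add: distinct_card)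
  show "inj_on (ends G) C"
  proof (rule inj_onI)
    fix x y assume x: "x \<in> C" and y: "y \<in> C" and eq: "ends G x = ends G y"
    obtain i where i: "i < length es" "x = es ! i" using x unfolding C(4) in_set_conv_nth by blast
    obtain j where j: "j < length es" "y = es ! j" using y unfolding C(4) in_set_conv_nth by blast
    have "i = j"
      using distinct_pair_inj[OF C(2), of i j] len eq C(1) C(5)[OF i(1)] C(5)[OF j(1)] i j by simp
    then show "x = y" using i j by simp
  qed
  fix e assume "e \<in> C"
  then obtain i where i: "i < length es" "e = es ! i" unfolding C(4) in_set_conv_nth by blast
  have "Suc i mod length es \<noteq> i"
    by (rule Suc_mod_neq[OF i(1)]) (use len C(1) in simp)
  moreover have "Suc i mod length es < length es"
    by (rule mod_less_divisor) (use i(1) in linarith)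
  ultimately have "vs ! i \<noteq> vs ! (Suc i mod length es)"
    using nth_eq_iff_index_eq[OF C(2), of i "Suc i mod length es"] i(1) C(1) by simp
  then show "\<not> is_loop G e" using C(5)[OF i(1)] i(2) by (simp add: is_loop_def)
qed

lemma path_between_card:
  assumes "path_between G x y vs es" "x \<noteq> y"
  shows "set es \<subseteq> edges G" "es \<noteq> []" "vertices_of G (set es) = set vs" "card (set vs) = card (set es) + 1"
proof -
  have p: "length vs = Suc (length es)" "distinct vs" "set es \<subseteq> edges G"
    "\<And>i. i < length es \<Longrightarrow> ends G (es ! i) = {vs ! i, vs ! Suc i}" "hd vs = x" "last vs = y"
    using assms(1) unfolding path_between_def is_path_def by blast+
  show "set es \<subseteq> edges G" by (rule p(3))
  show ne: "es \<noteq> []"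
  proof
    assume "es = []"
    then have "length vs = 1" using p(1) by simp
    then obtain v where "vs = [v]" by (auto simp: length_Suc_conv)
    then show False using p(5,6) assms(2) by simp
  qed
  have "vertices_of G (set es) = (\<Union>i<length es. ends G (es ! i))"
    unfolding vertices_of_def by (rule UN_set_nth)
  also have "\<dots> = (\<Union>i<length es. {vs ! i, vs ! Suc i})"
    using p(4) by simp
  also have "\<dots> = set vs"
  proof
    show "(\<Union>i<length es. {vs ! i, vs ! Suc i}) \<subseteq> set vs" using p(1) by auto
    show "set vs \<subseteq> (\<Union>i<length es. {vs ! i, vs ! Suc i})"
    proof
      fix v assume "v \<in> set vs"
      then obtain i where i: "i < length vs" "v = vs ! i" unfolding in_set_conv_nth by blast
      show "v \<in> (\<Union>i<length es. {vs ! i, vs ! Suc i})"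
      proof (cases "i < length es")
        case True
        then show ?thesis using i(2) by blast
      next
        case False
        then have "i = Suc (length es - 1)" "length es - 1 < length es" using i(1) p(1) ne by auto
        then show ?thesis using i(2) by blast
      qed
    qed
  qed
  finally show "vertices_of G (set es) = set vs" .
  \<comment> \<open>This is not part of \<open>is_path\<close>; it follows from the distinctness of
    the vertices.\<close>
  have "distinct es"
    unfolding distinct_conv_nth
  proof (intro allI impI notI)
    fix i j assume ij: "i < length es" "j < length es" "i \<noteq> j" "es ! i = es ! j"
    then have "{vs ! i, vs ! Suc i} = {vs ! j, vs ! Suc j}" using p(4) by metis
    then have "{i, Suc i} = {j, Suc j}"
      using nth_eq_iff_index_eq[OF p(2)] ij(1,2) p(1) by (simp add: doubleton_eq_iff)
    then show False using ij(3) by (auto simp: doubleton_eq_iff)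
  qed
  then show "card (set vs) = card (set es) + 1" using p(1,2) by (simp add: distinct_card)
qed

lemma vertices_of_Un: "vertices_of G (X \<union> Y) = vertices_of G X \<union> vertices_of G Y"
  by (simp add: vertices_of_def)

text \<open>Let s be the sum of the vertex numbers of the three paths. The paths have s - 3 edges
  together, and s - 4 vertices because each of the two common ends is counted three times.\<close>

lemma is_thetaD:
  assumes "is_theta G T"
  shows "T \<subseteq> edges G" "T \<noteq> {}" "card T = card (vertices_of G T) + 1"
proof -
  obtain x y vs1 es1 vs2 es2 vs3 es3 where xy: "x \<noteq> y"
    and p: "path_between G x y vs1 es1" "path_between G x y vs2 es2" "path_between G x y vs3 es3"
    and v: "set vs1 \<inter> set vs2 = {x, y}" "set vs1 \<inter> set vs3 = {x, y}" "set vs2 \<inter> set vs3 = {x, y}"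
    and e: "set es1 \<inter> set es2 = {}" "set es1 \<inter> set es3 = {}" "set es2 \<inter> set es3 = {}"
    and T: "T = set es1 \<union> set es2 \<union> set es3"
    using assms unfolding is_theta_def by blast
  note c = path_between_card[OF p(1) xy] path_between_card[OF p(2) xy] path_between_card[OF p(3) xy]
  show "T \<subseteq> edges G" "T \<noteq> {}" unfolding T using c(1,2,5,9) by simp_all
  have "vertices_of G T = set vs1 \<union> set vs2 \<union> set vs3"
    unfolding T vertices_of_Un c ..
  moreover have "card (set vs1 \<union> set vs2) + 2 = card (set vs1) + card (set vs2)"
    using card_Un_Int[of "set vs1" "set vs2"] v(1) xy by simp
  moreover have "(set vs1 \<union> set vs2) \<inter> set vs3 = {x, y}" using v by blast
  then have "card (set vs1 \<union> set vs2 \<union> set vs3) + 2 = card (set vs1 \<union> set vs2) + card (set vs3)"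
    using card_Un_Int[of "set vs1 \<union> set vs2" "set vs3"] xy by simp
  moreover have "card T = card (set es1) + card (set es2) + card (set es3)"
    unfolding T using e by (simp add: card_Un_disjoint Int_Un_distrib2)
  ultimately show "card T = card (vertices_of G T) + 1" using c by simp
qed

lemma is_cycle_loop:
  assumes "e \<in> edges G" "is_loop G e"
  shows "is_cycle G {e}"
proof -
  obtain v where "ends G e = {v}" using assms(2) by (auto simp: is_loop_def card_1_singleton_iff)
  then show ?thesis using assms(1) unfolding is_cycle_def
    by (intro exI[of _ "[v]"] exI[of _ "[e]"]) simp
qed

lemma is_cycle_parallel:
  assumes "x \<in> edges G" "y \<in> edges G" "x \<noteq> y" "ends G x = ends G y" "card (ends G x) = 2"
  shows "is_cycle G {x, y}"
proof -
  obtain u v where "ends G x = {u, v}" "u \<noteq> v" using assms(5) by (auto simp: card_2_iff)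
  then have "ends G ([x, y] ! i) = {[u, v] ! i, [u, v] ! (Suc i mod 2)}" if "i < 2" for i
    using that assms(4) by (cases "i = 0") (simp_all add: less_2_cases_iff insert_commute)
  then show ?thesis using assms(1-3) \<open>u \<noteq> v\<close> unfolding is_cycle_def
    by (intro exI[of _ "[u, v]"] exI[of _ "[x, y]"]) (simp add: numeral_2_eq_2)
qed

lemma path_between_edge:
  assumes "e \<in> edges G" "ends G e = {u, v}" "u \<noteq> v"
  shows "path_between G u v [u, v] [e]"
  using assms by (simp add: path_between_def is_path_def)

lemma is_theta_parallel:
  assumes "{x, y, z} \<subseteq> edges G" "x \<noteq> y" "x \<noteq> z" "y \<noteq> z"
    "ends G x = ends G y" "ends G x = ends G z" "card (ends G x) = 2"
  shows "is_theta G {x, y, z}"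
proof -
  obtain u v where "ends G x = {u, v}" "u \<noteq> v" using assms(7) by (auto simp: card_2_iff)
  then have "path_between G u v [u, v] [x]" "path_between G u v [u, v] [y]" "path_between G u v [u, v] [z]"
    using assms(1,5,6) by (simp_all add: path_between_edge)
  then show ?thesis using assms(2-4) \<open>u \<noteq> v\<close> unfolding is_theta_def
    by (intro exI[of _ u] exI[of _ v] exI[of _ "[u, v]"] exI[of _ "[x]"] exI[of _ "[y]"] exI[of _ "[z]"])
      (simp add: insert_commute)
qed

lemma in_2_cycle_iff:
  assumes "multigraph G" "e \<in> edges G" "\<not> is_loop G e"
  shows "in_2_cycle G e \<longleftrightarrow> (\<exists>f\<in>edges G. f \<noteq> e \<and> ends G f = ends G e)"
proof
  assume "in_2_cycle G e"
  then obtain C where C: "is_cycle G C" "card C = 2" "e \<in> C" unfolding in_2_cycle_def by blast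
  obtain vs es where c: "length vs = length es" "distinct es" "set es \<subseteq> edges G" "C = set es"
    "\<And>i. i < length es \<Longrightarrow> ends G (es ! i) = {vs ! i, vs ! (Suc i mod length es)}"
    using C(1) unfolding is_cycle_def by blast
  have len: "length es = 2" using C(2) c(2,4) by (simp add: distinct_card)
  then obtain x y where es: "es = [x, y]" by (auto simp: numeral_2_eq_2 length_Suc_conv)
  have "ends G x = {vs ! 0, vs ! 1}" "ends G y = {vs ! 1, vs ! 0}"
    using c(5)[of 0] c(5)[of 1] es by simp_all
  then have "ends G x = ends G y" by (simp add: insert_commute)
  moreover have "x \<noteq> y" using c(2) es by simp
  moreover have "e = x \<or> e = y" "x \<in> edges G" "y \<in> edges G" using C(3) c(3,4) es by auto
  ultimately show "\<exists>f\<in>edges G. f \<noteq> e \<and> ends G f = ends G e" by auto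
next
  assume "\<exists>f\<in>edges G. f \<noteq> e \<and> ends G f = ends G e"
  then obtain f where f: "f \<in> edges G" "e \<noteq> f" "ends G e = ends G f" by metis
  have "card (ends G e) = 2"
    using assms unfolding multigraph_def is_loop_def by blast
  then have "is_cycle G {e, f}" using is_cycle_parallel[OF assms(2) f] by blast
  then show "in_2_cycle G e" using f(2) unfolding in_2_cycle_def by (intro exI[of _ "{e, f}"]) simp
qed

text \<open>\<open>vs\<close> lists the vertices of the underlying cycle in cyclic order.\<close>

locale fat_cycle =
  fixes G :: "('v, 'e) mgraph" and vs :: "'v list"
  assumes mg: "multigraph G"
    and dist: "distinct vs" and len: "7 \<le> length vs" and verts: "verts G = set vs"
    and classes: "ends G ` {e \<in> edges G. \<not> is_loop G e} =
      (\<lambda>i. {vs ! i, vs ! (Suc i mod length vs)}) ` {..<length vs}"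
begin

definition pair :: "nat \<Rightarrow> 'v set" where
  "pair i = {vs ! i, vs ! (Suc i mod length vs)}"

abbreviation "n \<equiv> length vs"
abbreviation "L \<equiv> {e. is_loop G e}"
abbreviation "a \<equiv> num_classes (ends G) L"

lemma finite_edges: "finite (edges G)"
  using mg by (simp add: multigraph_def)

lemma finE: "X \<subseteq> edges G \<Longrightarrow> finite X"
  using finite_edges finite_subset by blast

lemma pair_inj: "inj_on pair {..<n}"
  using distinct_pair_inj[OF dist] len unfolding inj_on_def pair_def by auto

lemma ends_classes: "ends G ` (edges G - L) = pair ` {..<n}"
proof -
  have "edges G - L = {e \<in> edges G. \<not> is_loop G e}" by blast
  then show ?thesis using classes by (simp add: pair_def)
qed

lemma num_classes_edges: "a (edges G) = n"
  using card_image[OF pair_inj] by (simp add: num_classes_def ends_classes)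

lemma card_ends: "e \<in> edges G \<Longrightarrow> \<not> is_loop G e \<Longrightarrow> card (ends G e) = 2"
  using mg unfolding multigraph_def is_loop_def by blast

lemma a_le_n: "X \<subseteq> edges G \<Longrightarrow> a X \<le> n"
  using num_classes_mono[OF _ finite_edges, of X "ends G" L] num_classes_edges by simp

text \<open>A proper nonempty subset of the cyclic order has a last element, and the following vertex is
  one vertex more than there are classes.\<close>

lemma card_vertices_gt:
  assumes X: "X \<subseteq> edges G" "X \<noteq> {}" "a X < n"
  shows "a X + 1 \<le> card (vertices_of G X)"
proof -
  define I where "I = {i. i < n \<and> pair i \<in> ends G ` (X - L)}"
  have In: "I \<subseteq> {..<n}" "finite I" by (auto simp: I_def)
  have "ends G ` (X - L) \<subseteq> ends G ` (edges G - L)" using X(1) by (intro image_mono) blast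
  then have cover: "ends G ` (X - L) \<subseteq> pair ` {..<n}" by (simp add: ends_classes)
  have "ends G ` (X - L) = pair ` I"
  proof
    show "ends G ` (X - L) \<subseteq> pair ` I"
    proof
      fix c assume c: "c \<in> ends G ` (X - L)"
      then have "c \<in> pair ` {..<n}" using cover by (rule subsetD[rotated])
      then obtain i where i: "c = pair i" "i \<in> {..<n}" by (rule imageE)
      then have "i \<in> I" using c by (simp add: I_def)
      then show "c \<in> pair ` I" using i(1) by simp
    qed
    show "pair ` I \<subseteq> ends G ` (X - L)"
      by (rule image_subsetI) (simp add: I_def)
  qed
  moreover have "inj_on pair I" using pair_inj In(1) inj_on_subset by blast
  ultimately have aI: "a X = card I" by (simp add: num_classes_def card_image)
  have fV: "finite (vertices_of G X)" by (rule finite_vertices_of[OF mg X(1)])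
  have inV: "pair i \<subseteq> vertices_of G X" if "i \<in> I" for i
  proof -
    have "pair i \<in> ends G ` (X - L)" using that by (simp add: I_def)
    then obtain e where "pair i = ends G e" "e \<in> X - L" by (rule imageE)
    then show ?thesis unfolding vertices_of_def by blast
  qed
  show ?thesis
  proof (cases "I = {}")
    case True
    obtain e where e: "e \<in> X" using X(2) by blast
    then have "card (ends G e) \<in> {1, 2}" using mg X(1) unfolding multigraph_def by blast
    then have "ends G e \<noteq> {}" by auto
    then have "vertices_of G X \<noteq> {}" using e unfolding vertices_of_def by blast
    then have "1 \<le> card (vertices_of G X)" using fV by (simp add: Suc_le_eq card_gt_0_iff)
    then show ?thesis using aI True by simp
  next
    case False
    have "\<exists>i\<in>I. Suc i mod n \<notin> I"
    proof (rule ccontr)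
      assume "\<not> ?thesis"
      then have step: "Suc i mod n \<in> I" if "i \<in> I" for i using that by blast
      obtain i where i: "i \<in> I" using False by blast
      have iter: "(i + k) mod n \<in> I" for k
      proof (induction k)
        case 0
        then show ?case using i In(1) by auto
      next
        case (Suc k)
        then show ?case using step[OF Suc] by (simp add: mod_Suc_eq)
      qed
      have "{..<n} \<subseteq> I"
      proof
        fix j assume j: "j \<in> {..<n}"
        \<comment> \<open>From \<open>i\<close> the index \<open>j\<close> is reached in
          \<open>j + n - i\<close> cyclic steps; the summand \<open>n\<close> keeps the subtraction
          exact when \<open>j < i\<close>.\<close>
        have "i < n" using i In(1) by auto
        then have "i + (j + n - i) = j + n" by simp
        then have "(i + (j + n - i)) mod n = j" using j by simp
        then show "j \<in> I" using iter[of "j + n - i"] by simp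
      qed
      then have "I = {..<n}" using In(1) by (rule subset_antisym[rotated])
      then have "card I = n" by simp
      then show False using aI X(3) by simp
    qed
    then obtain i where i: "i \<in> I" "Suc i mod n \<notin> I" by blast
    let ?v = "vs ! (Suc i mod n)"
    have sub: "insert ?v ((!) vs ` I) \<subseteq> vertices_of G X"
    proof (intro insert_subsetI image_subsetI)
      show "?v \<in> vertices_of G X" using inV[OF i(1)] by (simp add: pair_def)
      show "vs ! k \<in> vertices_of G X" if "k \<in> I" for k
        using inV[OF that] by (simp add: pair_def)
    qed
    have lt: "Suc i mod n < n" using len by (intro mod_less_divisor) auto
    have inj: "inj_on ((!) vs) {..<n}"
      using nth_eq_iff_index_eq[OF dist] by (auto simp: inj_on_def)
    have "?v \<notin> (!) vs ` I"
    proof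
      assume "?v \<in> (!) vs ` I"
      then obtain j where j: "?v = vs ! j" "j \<in> I" by (rule imageE)
      then have "Suc i mod n = j"
        using nth_eq_iff_index_eq[OF dist, of "Suc i mod n" j] lt In(1) by auto
      then show False using i(2) j(2) by simp
    qed
    moreover have "card ((!) vs ` I) = card I"
      by (rule card_image[OF inj_on_subset[OF inj In(1)]])
    ultimately have "card (insert ?v ((!) vs ` I)) = card I + 1" using In(2) by simp
    then show ?thesis using card_mono[OF fV sub] aI by simp
  qed
qed

lemma vertices_of_full:
  assumes "X \<subseteq> edges G" "a X = n"
  shows "vertices_of G X = verts G"
proof
  show "vertices_of G X \<subseteq> verts G"
    using mg assms(1) unfolding multigraph_def vertices_of_def by blast
  have "ends G ` (X - L) = ends G ` (edges G - L)"
    using assms num_classes_edges finite_edges unfolding num_classes_def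
    by (intro card_subset_eq) auto
  then have cover: "ends G ` (X - L) = pair ` {..<n}" by (simp add: ends_classes)
  show "verts G \<subseteq> vertices_of G X"
  proof
    fix v assume "v \<in> verts G"
    then obtain i where i: "i < n" "v = vs ! i" unfolding verts in_set_conv_nth by blast
    then have "pair i \<in> ends G ` (X - L)" unfolding cover by simp
    then obtain e where "pair i = ends G e" "e \<in> X - L" by (rule imageE)
    moreover have "v \<in> pair i" using i(2) by (simp add: pair_def)
    ultimately show "v \<in> vertices_of G X" unfolding vertices_of_def by blast
  qed
qed

text \<open>A cycle has as many edges as vertices, so missing a class forces positive excess by
  \<open>card_vertices_gt\<close>. A cycle meeting all classes has at least three edges, hence
  neither loops nor parallel edges.\<close>

lemma cycle_cases:
  assumes "is_cycle G C"
  shows "a C = n \<and> card C = n \<or> a C < n \<and> a C < card C"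
proof (cases "a C = n")
  case True
  have C: "C \<subseteq> edges G" "finite C" using is_cycleD[OF assms] by auto
  have "3 \<le> card C"
    using num_classes_le_card[OF C(2), of "ends G" L] True len by simp
  then have "inj_on (ends G) C" "C \<inter> L = {}" using is_cycle_long[OF assms] by auto
  then have "a C = card C" using num_classes_eq_card_iff[OF C(2), of "ends G" L] by simp
  then show ?thesis using True by simp
next
  case False
  have C: "C \<subseteq> edges G" "C \<noteq> {}" "card (vertices_of G C) = card C" using is_cycleD[OF assms] by auto
  have "a C < n" using a_le_n[OF C(1)] False by simp
  then show ?thesis using card_vertices_gt[OF C(1,2)] C(3) by simp
qed

lemma long_cycle_full:
  assumes "is_cycle G C" "3 \<le> card C"
  shows "a C = n" "card C = n"
proof -
  have C: "finite C" using is_cycleD[OF assms(1)] by auto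
  have "inj_on (ends G) C" "C \<inter> L = {}" using is_cycle_long[OF assms] by auto
  then have "a C = card C" using num_classes_eq_card_iff[OF C, of "ends G" L] by simp
  then show "a C = n" "card C = n" using cycle_cases[OF assms(1)] by auto
qed

text \<open>The extra edge of a theta adds one to the bound that \<open>card_vertices_gt\<close>
  gives for cycles, so a theta missing a class has excess at least 2.\<close>

lemma theta_cases:
  assumes "is_theta G T"
  shows "a T = n \<and> card T = n + 1 \<or> a T < n \<and> a T + 2 \<le> card T"
proof (cases "a T = n")
  case True
  then have "card (vertices_of G T) = n"
    using vertices_of_full[OF is_thetaD(1)[OF assms]] distinct_card[OF dist] verts by simp
  then show ?thesis using True is_thetaD(3)[OF assms] by simp
next
  case False
  have "a T < n" using a_le_n[OF is_thetaD(1)[OF assms]] False by simp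
  then show ?thesis using card_vertices_gt[OF is_thetaD(1,2)[OF assms]] is_thetaD(3)[OF assms] by simp
qed

lemma Hamilton_list:
  assumes T: "T \<subseteq> edges G" "a T = n" "card T = n"
  shows "\<exists>es. length es = n \<and> distinct es \<and> set es = T \<and> (\<forall>i<n. ends G (es ! i) = pair i)"
proof -
  have inj: "T \<inter> L = {}" "inj_on (ends G) T"
    using num_classes_eq_card_iff[OF finE[OF T(1)], of "ends G" L] T by auto
  have TL: "T - L = T" using inj(1) by blast
  have "ends G ` (T - L) = ends G ` (edges G - L)"
    using T num_classes_edges finite_edges unfolding num_classes_def
    by (intro card_subset_eq) auto
  then have ET: "ends G ` T = pair ` {..<n}" unfolding ends_classes TL .
  define g where "g i = inv_into T (ends G) (pair i)" for i
  have g: "g i \<in> T" "ends G (g i) = pair i" if "i < n" for i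
  proof -
    have "pair i \<in> ends G ` T" unfolding ET using that by simp
    then show "g i \<in> T" "ends G (g i) = pair i"
      unfolding g_def by (rule inv_into_into, rule f_inv_into_f)
  qed
  have injg: "inj_on g {..<n}"
  proof (rule inj_onI)
    fix i j assume ij: "i \<in> {..<n}" "j \<in> {..<n}" "g i = g j"
    then have "pair i = pair j" using g(2)[of i] g(2)[of j] by simp
    then show "i = j" by (rule inj_onD[OF pair_inj]) (use ij in simp_all)
  qed
  have "g ` {..<n} = T"
    by (rule card_subset_eq) (use finE[OF T(1)] g card_image[OF injg] T(3) in auto)
  then show ?thesis
    using injg g(2) by (intro exI[of _ "map g [0..<n]"]) (simp_all add: distinct_map atLeast0LessThan)
qed

lemma is_cycle_Hamilton:
  assumes "T \<subseteq> edges G" "a T = n" "card T = n"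
  shows "is_cycle G T"
proof -
  obtain es where es: "length es = n" "distinct es" "set es = T" "\<And>i. i < n \<Longrightarrow> ends G (es ! i) = pair i"
    using Hamilton_list[OF assms] by blast
  then show ?thesis
    unfolding is_cycle_def using dist len assms(1)
    by (intro exI[of _ vs] exI[of _ es]) (auto simp: pair_def)
qed

text \<open>The three paths are \<open>x\<close>, the edge \<open>es ! j\<close> of \<open>T\<close>
  parallel to it, and the rest of \<open>T\<close>.\<close>

lemma is_theta_Hamilton:
  assumes T: "T \<subseteq> edges G" "a T = n" "card T = n" and x: "x \<in> edges G - T" "\<not> is_loop G x"
  shows "is_theta G (insert x T)"
proof -
  obtain es where es: "length es = n" "distinct es" "set es = T" "\<And>i. i < n \<Longrightarrow> ends G (es ! i) = pair i"
    using Hamilton_list[OF T] by blast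
  have "ends G x \<in> ends G ` (edges G - L)" using x by blast
  then have "ends G x \<in> pair ` {..<n}" unfolding ends_classes .
  then obtain j where j: "ends G x = pair j" "j < n" by auto
  let ?u = "vs ! (Suc j mod n)" and ?w = "vs ! j"
  \<comment> \<open>Rotating by \<open>Suc j\<close> starts the vertices at \<open>?u\<close>, ends
    them at \<open>?w\<close> and puts \<open>es ! j\<close> last among the edges, so dropping the
    last edge leaves the long path.\<close>
  let ?vs = "rotate (Suc j) vs" and ?r = "rotate (Suc j) es"
  let ?es = "take (n - 1) ?r"
  have nth: "?vs ! i = vs ! ((Suc j + i) mod n)" "?r ! i = es ! ((Suc j + i) mod n)" if "i < n" for i
    using nth_rotate[of i vs "Suc j"] nth_rotate[of i es "Suc j"] that es(1) by simp_all
  have "Suc j + (n - 1) = j + n" using len by simp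
  then have lastj: "(Suc j + (n - 1)) mod n = j" using j(2) by (simp only: mod_add_self2 mod_less)
  have lt: "k mod n < n" for k using len by (intro mod_less_divisor) auto
  have uw: "?u \<noteq> ?w"
    using nth_eq_iff_index_eq[OF dist lt j(2)] Suc_mod_neq[OF j(2)] len by simp
  have nonempty: "vs \<noteq> []" "es \<noteq> []" using len es(1) by auto
  have r: "?r = ?es @ [es ! j]"
  proof -
    have "?r = take (n - 1) ?r @ [?r ! (n - 1)]"
      using take_Suc_conv_app_nth[of "n - 1" ?r] es(1) len by simp
    then show ?thesis using nth(2)[of "n - 1"] lastj len by simp
  qed
  have "distinct ?r" "set ?r = T" using es(2,3) by simp_all
  then have dr: "es ! j \<notin> set ?es" "T = insert (es ! j) (set ?es)"
    using r by (metis distinct_append disjoint_iff list.set_intros(1), 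
                metis insert_is_Un Un_commute list.simps(15) set_append empty_set)
  have ej: "es ! j \<in> T" using dr(2) by blast
  have p1: "path_between G ?u ?w ?vs ?es"
    unfolding path_between_def is_path_def
  proof (intro conjI allI impI)
    show "length ?vs = Suc (length ?es)" using es(1) len by simp
    show "distinct ?vs" using dist by simp
    show "set ?es \<subseteq> edges G" using dr(2) T(1) by blast
    show "hd ?vs = ?u" using hd_rotate_conv_nth[OF nonempty(1), of "Suc j"] by simp
    have "last ?vs = ?vs ! (n - 1)" using nonempty(1) by (simp add: last_conv_nth)
    then show "last ?vs = ?w" using nth(1)[of "n - 1"] lastj len by simp
    fix i assume "i < length ?es"
    then have i: "i < n - 1" using es(1) by simp
    then have "?es ! i = es ! ((Suc j + i) mod n)" using nth(2)[of i] by simp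
    then have "ends G (?es ! i) = pair ((Suc j + i) mod n)" using es(4)[OF lt] by simp
    moreover have "Suc ((Suc j + i) mod n) mod n = (Suc j + Suc i) mod n" by (simp add: mod_Suc_eq)
    ultimately show "ends G (?es ! i) = {?vs ! i, ?vs ! Suc i}"
      using nth(1)[of i] nth(1)[of "Suc i"] i by (simp add: pair_def)
  qed
  have eq: "ends G (es ! j) = {?u, ?w}" "ends G x = {?u, ?w}"
    using es(4)[OF j(2)] j(1) by (simp_all add: pair_def insert_commute)
  have p2: "path_between G ?u ?w [?u, ?w] [es ! j]"
    by (rule path_between_edge[OF _ eq(1) uw]) (use ej T(1) in blast)
  have p3: "path_between G ?u ?w [?u, ?w] [x]"
    by (rule path_between_edge[OF _ eq(2) uw]) (use x(1) in blast)
  have "?u \<in> set vs" "?w \<in> set vs" using lt j(2) by auto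
  then have v: "set ?vs \<inter> set [?u, ?w] = {?u, ?w}" by auto
  have v2: "set [?u, ?w] \<inter> set [?u, ?w] = {?u, ?w}" by simp
  have e1: "set ?es \<inter> set [es ! j] = {}" using dr(1) by simp
  have e2: "set ?es \<inter> set [x] = {}" using x(1) dr(2) by auto
  have e3: "set [es ! j] \<inter> set [x] = {}" using x(1) ej by auto
  have "insert x T = set ?es \<union> set [es ! j] \<union> set [x]" using dr(2) by auto
  then show ?thesis
    unfolding is_theta_def using uw p1 p2 p3 v v2 e1 e2 e3 by blast
qed

end

section \<open>Independent sets of the lift matroid\<close>

lemma lift_matroid_simps:
  "ground (lift_matroid G B) = edges G"
  "indep (lift_matroid G B) I \<longleftrightarrow> I \<subseteq> edges G \<and> \<not> (\<exists>C\<in>lift_circuits G B. C \<subseteq> I)"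
  by (simp_all add: lift_matroid_def matroid_of_circuits_def)

lemma theta_lift_circuit:
  assumes "is_theta G T" "\<And>C. is_cycle G C \<Longrightarrow> C \<subseteq> T \<Longrightarrow> unbalanced_cycle G B C"
  shows "T \<in> lift_circuits G B"
  unfolding lift_circuits_def using assms by (intro UnI1 UnI2 CollectI) simp

lemma tight_handcuff_lift_circuit:
  assumes "unbalanced_cycle G B C" "unbalanced_cycle G B D" "C \<inter> D = {}"
    "card (vertices_of G C \<inter> vertices_of G D) = 1"
  shows "C \<union> D \<in> lift_circuits G B"
  unfolding lift_circuits_def using assms by (intro UnI1 UnI2 CollectI exI[of _ C] exI[of _ D]) simp

lemma disjoint_lift_circuit:
  assumes "unbalanced_cycle G B C" "unbalanced_cycle G B D"
    "vertices_of G C \<inter> vertices_of G D = {}"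
  shows "C \<union> D \<in> lift_circuits G B"
  unfolding lift_circuits_def using assms by (intro UnI2 CollectI exI[of _ C] exI[of _ D]) simp

context fat_cycle
begin

text \<open>The cycle is a loop or a 2-cycle, so its vertices are the ends of \<open>x\<close>. The
  last conjunct serves to show that two such cycles are edge-disjoint.\<close>

lemma cycle_through_extra:
  assumes T: "T \<subseteq> edges G - L" and x: "x \<in> edges G" "x \<notin> T" "\<not> is_loop G x \<Longrightarrow> ends G x \<in> ends G ` T"
  shows "\<exists>C. is_cycle G C \<and> x \<in> C \<and> C \<subseteq> insert x T \<and> vertices_of G C = ends G x \<and>
    (\<forall>t\<in>C. t \<noteq> x \<longrightarrow> ends G t = ends G x \<and> \<not> is_loop G x)"
proof (cases "is_loop G x")
  case True
  then show ?thesis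
    using is_cycle_loop[OF x(1)] by (intro exI[of _ "{x}"]) (simp_all add: vertices_of_def)
next
  case False
  then obtain t where t: "ends G x = ends G t" "t \<in> T" using x(3) by blast
  have "t \<in> edges G" "x \<noteq> t" using t(2) T x(2) by blast+
  then have "is_cycle G {x, t}"
    using is_cycle_parallel[OF x(1) _ _ t(1)] card_ends[OF x(1) False] by blast
  then show ?thesis
    using t False by (intro exI[of _ "{x, t}"]) (auto simp: vertices_of_def)
qed

text \<open>This makes the short cycles through \<open>x\<close> and \<open>y\<close> a tight
  handcuff or a vertex-disjoint pair. The alternative \<open>is_loop G x\<close> admits two loops at
  the same vertex.\<close>

lemma ends_inter_le_1:
  assumes "x \<in> edges G" "y \<in> edges G" "ends G x \<noteq> ends G y \<or> is_loop G x"
  shows "card (ends G x \<inter> ends G y) \<le> 1"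
proof (rule ccontr)
  assume "\<not> ?thesis"
  then have two: "2 \<le> card (ends G x \<inter> ends G y)" by simp
  have c: "card (ends G x) \<in> {1, 2}" "card (ends G y) \<in> {1, 2}"
    using assms(1,2) mg unfolding multigraph_def by blast+
  then have fins: "finite (ends G x)" "finite (ends G y)"
    by (metis card.infinite insert_iff singletonD zero_neq_numeral zero_neq_one)+
  have "ends G x \<inter> ends G y = ends G x" "ends G x \<inter> ends G y = ends G y"
    by (rule card_seteq; use fins two c in auto)+
  then have "ends G x = ends G y" by simp
  then have "is_loop G x" using assms(3) by blast
  then show False using two \<open>ends G x = ends G y\<close> by (simp add: is_loop_def)
qed

end

locale simple_fat_cycle = fat_cycle G vs for G :: "('v, 'e) mgraph" and vs +
  fixes B :: "'e set set"
  assumes biased: "biased_graph G B" and simple: "simple_matroid (lift_matroid G B)"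
begin

lemma balanced_cycle: "C \<in> B \<Longrightarrow> is_cycle G C"
  using biased by (simp add: biased_graph_def)

text \<open>A balanced cycle is dependent and so contains a circuit, which has at least three edges
  by simplicity. A cycle with three or more edges goes all the way round.\<close>

lemma balanced_Hamilton:
  assumes "C \<in> B"
  shows "a C = n" "card C = n"
proof -
  have C: "C \<subseteq> edges G" "finite C" using is_cycleD[OF balanced_cycle[OF assms]] by auto
  have "C \<in> lift_circuits G B" using assms by (simp add: lift_circuits_def)
  then have "\<not> indep (lift_matroid G B) C" by (auto simp: lift_matroid_simps)
  then obtain D where D: "D \<subseteq> C" "circuit (lift_matroid G B) D"
    using obtain_circuit[of C "lift_matroid G B"] C lift_matroid_simps(1) by metis
  then have "3 \<le> card D" using simple by (simp add: simple_matroid_def)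
  then have "3 \<le> card C" using card_mono[OF C(2) D(1)] by simp
  then show "a C = n" "card C = n" using long_cycle_full[OF balanced_cycle[OF assms]] by blast+
qed

text \<open>For thetas this is \<open>theta_cases\<close>. In a union of two disjoint cycles each
  cycle has excess at least 1, so the union has excess at least 2, unless one is a Hamilton cycle;
  then the other brings the size above \<open>n\<close>.\<close>

lemma lift_circuit_excess:
  assumes Z: "Z \<in> lift_circuits G B" "Z \<notin> B"
  shows "a Z = n \<and> n < card Z \<or> a Z + 2 \<le> card Z"
proof -
  have handcuff: "a (C \<union> D) = n \<and> n < card (C \<union> D) \<or> a (C \<union> D) + 2 \<le> card (C \<union> D)"
    if cyc: "is_cycle G C" "is_cycle G D" and disj: "C \<inter> D = {}" for C D
  proof -
    note C = is_cycleD[OF cyc(1)] and D = is_cycleD[OF cyc(2)]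
    have sub: "C \<union> D \<subseteq> edges G" using C(1) D(1) by blast
    have "card (C \<union> D) = card C + card D" by (rule card_Un_disjoint[OF C(3) D(3) disj])
    moreover have "0 < card C" "0 < card D" using C(2,3) D(2,3) by (auto simp: card_gt_0_iff)
    moreover have "a (C \<union> D) \<le> a C + a D" by (rule num_classes_Un_le)
    moreover have "a C \<le> a (C \<union> D)" "a D \<le> a (C \<union> D)"
      by (rule num_classes_mono[OF _ finE[OF sub]]; blast)+
    moreover have "a (C \<union> D) \<le> n" by (rule a_le_n[OF sub])
    ultimately show ?thesis
      using cycle_cases[OF cyc(1)] cycle_cases[OF cyc(2)] by (elim disjE) auto
  qed
  \<comment> \<open>The last kind of circuit in \<open>lift_circuits\<close> asks only for disjoint
    vertex sets; edge-disjointness follows because every edge has an end.\<close>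
  have vdisj: "C \<inter> D = {}" if "vertices_of G C \<inter> vertices_of G D = {}" "is_cycle G C" for C D
  proof (rule ccontr)
    assume "C \<inter> D \<noteq> {}"
    then obtain e where e: "e \<in> C" "e \<in> D" by blast
    have "card (ends G e) \<in> {1, 2}"
      using is_cycleD(1)[OF that(2)] e(1) mg unfolding multigraph_def by blast
    then have "ends G e \<noteq> {}" by auto
    moreover have "ends G e \<subseteq> vertices_of G C \<inter> vertices_of G D"
      using e unfolding vertices_of_def by blast
    ultimately show False using that(1) by blast
  qed
  show ?thesis
  proof (cases "is_theta G Z")
    case True
    then show ?thesis using theta_cases[OF True] by auto
  next
    case False
    then obtain C D where CD: "Z = C \<union> D" "is_cycle G C" "is_cycle G D"
      "C \<inter> D = {} \<or> vertices_of G C \<inter> vertices_of G D = {}"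
      using Z unfolding lift_circuits_def unbalanced_cycle_def by blast
    then have "C \<inter> D = {}" using vdisj by blast
    then show ?thesis using handcuff CD(1-3) by blast
  qed
qed

text \<open>Excess is monotone, so a set missing a class with excess at most 1 contains no lift
  circuit. Among \<open>n\<close> edges that meet all classes, a balanced cycle could only be the
  whole set.\<close>

lemma indep_if:
  assumes I: "I \<subseteq> edges G"
    and good: "a I < n \<and> card I \<le> a I + 1 \<or> a I = n \<and> card I = n \<and> I \<notin> B"
  shows "indep (lift_matroid G B) I"
  unfolding lift_matroid_simps
proof (intro conjI I notI)
  assume "\<exists>Z\<in>lift_circuits G B. Z \<subseteq> I"
  then obtain Z where Z: "Z \<in> lift_circuits G B" "Z \<subseteq> I" by blast
  have fI: "finite I" by (rule finE[OF I])
  have mono: "a Z \<le> a I" "a I + card Z \<le> a Z + card I"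
    by (rule num_classes_mono[OF Z(2) fI], rule num_classes_excess_mono[OF Z(2) fI])
  show False
  proof (cases "Z \<in> B")
    case True
    then have "a Z = n" "card Z = n" using balanced_Hamilton by auto
    then have "a I = n" "card I = n" "I \<notin> B" using mono good a_le_n[OF I] by auto
    then have "Z = I" using card_subset_eq[OF fI Z(2)] \<open>card Z = n\<close> by simp
    then show False using True \<open>I \<notin> B\<close> by simp
  next
    case False
    then show False using lift_circuit_excess[OF Z(1)] mono good a_le_n[OF I] by auto
  qed
qed

text \<open>A set \<open>T\<close> with one edge from each class met by \<open>I\<close> is fixed.
  Every other edge of \<open>I\<close> is a loop or closes a 2-cycle with \<open>T\<close>; two such
  edges produce a theta of three parallel edges or two short cycles sharing at most one vertex. So
  at most one edge lies outside \<open>T\<close>, and none if \<open>T\<close> is a Hamilton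
  cycle.\<close>

lemma only_if_indep:
  assumes "indep (lift_matroid G B) I"
  shows "a I < n \<and> card I \<le> a I + 1 \<or> a I = n \<and> card I = n \<and> I \<notin> B"
proof -
  have I: "I \<subseteq> edges G" and no: "\<And>Z. Z \<in> lift_circuits G B \<Longrightarrow> \<not> Z \<subseteq> I"
    using assms by (auto simp: lift_matroid_simps)
  have fI: "finite I" by (rule finE[OF I])
  have "B \<subseteq> lift_circuits G B" by (auto simp: lift_circuits_def)
  \<comment> \<open>With all its cycles unbalanced, \<open>I\<close> can contain no theta and no two
    edge-disjoint cycles sharing at most one vertex, since each of these would be a lift
    circuit.\<close>
  then have unb: "unbalanced_cycle G B C" if "is_cycle G C" "C \<subseteq> I" for C
    using that no unfolding unbalanced_cycle_def by blast
  have no_theta: "\<not> is_theta G Z" if "Z \<subseteq> I" for Z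
  proof
    assume "is_theta G Z"
    then have "Z \<in> lift_circuits G B"
      by (rule theta_lift_circuit) (use unb that in blast)
    then show False using no that by blast
  qed
  have no_handcuff: False
    if "is_cycle G C" "is_cycle G D" "C \<subseteq> I" "D \<subseteq> I" "C \<inter> D = {}"
      "card (vertices_of G C \<inter> vertices_of G D) \<le> 1" for C D
  proof -
    have u: "unbalanced_cycle G B C" "unbalanced_cycle G B D" using unb that by auto
    have fV: "finite (vertices_of G C)" using finite_vertices_of[OF mg is_cycleD(1)[OF that(1)]] .
    have "card (vertices_of G C \<inter> vertices_of G D) = 1 \<or> vertices_of G C \<inter> vertices_of G D = {}"
      using that(6) fV by (cases "vertices_of G C \<inter> vertices_of G D = {}") (simp_all add: le_Suc_eq)
    then have "C \<union> D \<in> lift_circuits G B"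
      using tight_handcuff_lift_circuit[OF u that(5)] disjoint_lift_circuit[OF u] by blast
    then show False using no that(3,4) by blast
  qed
  obtain T where T: "{} \<subseteq> T" "T \<subseteq> I - L" "inj_on (ends G) T" "ends G ` T = ends G ` (I - L)"
    by (rule extend_transversal[OF empty_subsetI inj_on_empty])
  have TI: "T \<subseteq> I" "T \<subseteq> edges G" "T \<subseteq> edges G - L" "T - L = T" "finite T"
    using T(2) I finite_subset[OF _ fI] by auto
  have aT: "a T = card T" "card T = a I"
    using card_image[OF T(3)] T(4) TI(4) by (simp_all add: num_classes_def)
  have par: "ends G x \<in> ends G ` T" if "x \<in> I" "\<not> is_loop G x" for x
    unfolding T(4) using that by simp
  have uniq: "x = y" if x: "x \<in> I - T" and y: "y \<in> I - T" for x y
  proof (rule ccontr)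
    assume "x \<noteq> y"
    have xI: "x \<in> I" and yI: "y \<in> I" using x y by auto
    have E: "x \<in> edges G" "y \<in> edges G" "x \<notin> T" "y \<notin> T" using x y I by auto
    show False
    proof (cases "ends G x \<noteq> ends G y \<or> is_loop G x")
      case True
      obtain C where C: "is_cycle G C" "x \<in> C" "C \<subseteq> insert x T" "vertices_of G C = ends G x"
        and Ct: "\<forall>t\<in>C. t \<noteq> x \<longrightarrow> ends G t = ends G x \<and> \<not> is_loop G x"
        using cycle_through_extra[OF TI(3) E(1,3) par[OF xI]] by blast
      obtain D where D: "is_cycle G D" "y \<in> D" "D \<subseteq> insert y T" "vertices_of G D = ends G y"
        and Dt: "\<forall>t\<in>D. t \<noteq> y \<longrightarrow> ends G t = ends G y \<and> \<not> is_loop G y"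
        using cycle_through_extra[OF TI(3) E(2,4) par[OF yI]] by blast
      have "C \<inter> D = {}"
      proof (rule ccontr)
        assume "C \<inter> D \<noteq> {}"
        then obtain t where t: "t \<in> C" "t \<in> D" by blast
        have "t \<noteq> x" "t \<noteq> y" using t C(3) D(3) E(3,4) \<open>x \<noteq> y\<close> by blast+
        then have "ends G t = ends G x \<and> \<not> is_loop G x" "ends G t = ends G y" using Ct Dt t by blast+
        then show False using True by simp
      qed
      moreover have "C \<subseteq> I" "D \<subseteq> I" using C(3) D(3) x y TI(1) by blast+
      moreover have "card (vertices_of G C \<inter> vertices_of G D) \<le> 1"
        unfolding C(4) D(4) by (rule ends_inter_le_1[OF E(1,2) True])
      ultimately show False using no_handcuff C(1) D(1) by blast
    next
      case False
      then have "ends G x \<in> ends G ` T" using par[OF xI] by blast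
      then obtain t where t: "ends G x = ends G t" "t \<in> T" by (rule imageE)
      have "is_theta G {x, y, t}"
      proof (rule is_theta_parallel)
        show "{x, y, t} \<subseteq> edges G" using E t(2) TI(2) by blast
        show "card (ends G x) = 2" using card_ends E(1) False by blast
        show "x \<noteq> t" "y \<noteq> t" using E t(2) by blast+
        show "ends G x = ends G y" using False by blast
      qed fact+
      moreover have "{x, y, t} \<subseteq> I" using x y t(2) TI(1) by blast
      ultimately show False using no_theta by blast
    qed
  qed
  have "card (I - T) \<le> 1"
    using uniq fI by (simp add: card_le_Suc0_iff_eq)
  moreover have "card I = card T + card (I - T)"
    using card_Diff_subset[OF TI(5,1)] card_mono[OF fI TI(1)] by simp
  ultimately have le: "card I \<le> a I + 1" using aT by simp
  show ?thesis
  proof (cases "a I = n")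
    case True
    have T3: "a T = n" "card T = n" using aT True by auto
    have ham: "is_cycle G T" by (rule is_cycle_Hamilton[OF TI(2) T3])
    have "I = T"
    proof (rule ccontr)
      assume "I \<noteq> T"
      then obtain x where x: "x \<in> I" "x \<notin> T" using TI(1) by blast
      have xE: "x \<in> edges G" using x I by blast
      show False
      proof (cases "is_loop G x")
        case True
        have one: "card (vertices_of G {x}) = 1" using True by (simp add: is_loop_def vertices_of_def)
        then have "finite (vertices_of G {x})" by (intro card_ge_0_finite) simp
        then have "card (vertices_of G T \<inter> vertices_of G {x}) \<le> 1"
          unfolding one[symmetric] by (rule card_mono) blast
        then show False
          using no_handcuff[OF ham is_cycle_loop[OF xE True] TI(1)] x by blast
      next
        case False
        have "is_theta G (insert x T)"
          by (rule is_theta_Hamilton[OF TI(2) T3]) (use x xE False in auto)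
        then show False using no_theta x(1) TI(1) by blast
      qed
    qed
    then have "I \<notin> B" using unb[OF ham TI(1)] by (simp add: unbalanced_cycle_def)
    then show ?thesis using T3 \<open>I = T\<close> by simp
  next
    case False
    then show ?thesis using a_le_n[OF I] le by simp
  qed
qed

text \<open>In the theta \<open>insert y H\<close> a balanced cycle is a transversal of the classes,
  so it avoids \<open>x\<close> or \<open>y\<close> and is \<open>H\<close> or the exchanged cycle.
  If both were balanced, the theta would contain exactly two balanced cycles.\<close>

lemma swap_unbalanced:
  assumes H: "H \<subseteq> edges G" "a H = n" "card H = n" "H \<in> B"
    and x: "x \<in> H" and y: "y \<in> edges G - H" "y \<notin> L" "ends G x = ends G y"
  shows "insert y (H - {x}) \<notin> B"
proof
  let ?H = "insert y (H - {x})"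
  assume H': "?H \<in> B"
  let ?T = "insert y H"
  have fH: "finite H" by (rule finE[OF H(1)])
  have theta: "is_theta G ?T"
    by (rule is_theta_Hamilton[OF H(1-3) y(1)]) (use y(2) in simp)
  have "{C \<in> B. C \<subseteq> ?T} = {H, ?H}"
  proof
    show "{H, ?H} \<subseteq> {C \<in> B. C \<subseteq> ?T}" using H(4) H' by auto
    show "{C \<in> B. C \<subseteq> ?T} \<subseteq> {H, ?H}"
    proof
      fix C assume "C \<in> {C \<in> B. C \<subseteq> ?T}"
      then have C: "C \<in> B" "C \<subseteq> ?T" by auto
      have cC: "a C = n" "card C = n" using balanced_Hamilton[OF C(1)] .
      have fC: "finite C" using C(2) fH finite_subset by blast
      have inj: "inj_on (ends G) C"
        using num_classes_eq_card_iff[OF fC, of "ends G" L] cC by simp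
      have "x \<noteq> y" using x y(1) by blast
      then have "x \<notin> C \<or> y \<notin> C" using inj y(3) by (auto simp: inj_on_def)
      then have "C \<subseteq> ?H \<or> C \<subseteq> H" using C(2) by blast
      moreover have "card ?H = n" using balanced_Hamilton(2)[OF H'] .
      ultimately have "C = ?H \<or> C = H"
        using card_subset_eq[of ?H C] card_subset_eq[OF fH, of C] fH cC(2) H(3) by auto
      then show "C \<in> {H, ?H}" by blast
    qed
  qed
  moreover have "H \<noteq> ?H" using x y(1) by blast
  ultimately have "card {C \<in> B. C \<subseteq> ?T} = 2" by simp
  then show False using biased theta by (simp add: biased_graph_def)
qed

sublocale lift: cyclic_lift "lift_matroid G B" L "ends G" B n
proof
  show "finite (ground (lift_matroid G B))" using finite_edges by (simp add: lift_matroid_simps)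
  show "num_classes (ends G) L (ground (lift_matroid G B)) = n"
    using num_classes_edges by (simp add: lift_matroid_simps)
  show "7 \<le> n" by (rule len)
  show "indep (lift_matroid G B) I \<longleftrightarrow> I \<subseteq> ground (lift_matroid G B) \<and>
      (a I < n \<and> card I \<le> a I + 1 \<or> a I = n \<and> card I = n \<and> I \<notin> B)" for I
    unfolding lift_matroid_simps(1)
  proof
    assume ind: "indep (lift_matroid G B) I"
    then have "I \<subseteq> edges G" by (simp add: lift_matroid_simps(2))
    then show "I \<subseteq> edges G \<and> (a I < n \<and> card I \<le> a I + 1 \<or> a I = n \<and> card I = n \<and> I \<notin> B)"
      using only_if_indep[OF ind] by (rule conjI)
  qed (elim conjE, rule indep_if)
  show "insert y (H - {x}) \<notin> B"
    if "H \<subseteq> ground (lift_matroid G B)" "a H = n" "card H = n" "H \<in> B" "x \<in> H"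
      "y \<in> ground (lift_matroid G B) - H" "y \<notin> L" "ends G x = ends G y" for H x y
    by (rule swap_unbalanced) (use that in \<open>simp_all add: lift_matroid_simps(1)\<close>)
qed

lemma thin_iff: "lift.thin e \<longleftrightarrow> e \<in> edges G \<and> \<not> is_loop G e \<and> \<not> in_2_cycle G e"
proof (cases "e \<in> edges G \<and> \<not> is_loop G e")
  case True
  have "f \<notin> L" if "ends G f = ends G e" for f
    using that True by (simp add: is_loop_def)
  then show ?thesis
    using True in_2_cycle_iff[OF mg, of e] unfolding lift.thin_def lift_matroid_simps(1) by blast
next
  case False
  then show ?thesis unfolding lift.thin_def lift_matroid_simps(1) by blast
qed

lemma thin_unique_iff:
  "card {e \<in> edges G. \<not> is_loop G e \<and> \<not> in_2_cycle G e} \<le> 1 \<longleftrightarrow> (\<forall>e f. lift.thin e \<longrightarrow> lift.thin f \<longrightarrow> e = f)"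
  using finite_edges by (auto simp: card_le_Suc0_iff_eq thin_iff)

end

section \<open>From the simplification to the fat cycle, and the theorem\<close>

lemma fat_cycle_exists:
  assumes "multigraph G" "is_cycle_graph (simplification G)" "card (verts G) > 6"
  shows "\<exists>vs. fat_cycle G vs"
proof -
  let ?S = "simplification G"
  have S: "edges ?S = ends G ` {e \<in> edges G. \<not> is_loop G e}" "ends ?S = (\<lambda>p. p)" "verts ?S = verts G"
    by (simp_all add: simplification_def)
  obtain vs ps where c: "ps \<noteq> []" "length vs = length ps" "distinct vs" "edges ?S = set ps"
    "\<And>i. i < length ps \<Longrightarrow> ends ?S (ps ! i) = {vs ! i, vs ! (Suc i mod length ps)}"
    using assms(2) unfolding is_cycle_graph_def is_cycle_def by blast
  \<comment> \<open>The edges of the simplification are the end pairs themselves, so the list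
    \<open>ps\<close> enumerates the parallel classes in cyclic order.\<close>
  have "set ps = (\<Union>i<length ps. {ps ! i})" by (rule set_conv_UN_nth)
  also have "\<dots> = (\<Union>i<length ps. {{vs ! i, vs ! (Suc i mod length vs)}})"
    using c(2,5) S(2) by simp
  also have "\<dots> = (\<lambda>i. {vs ! i, vs ! (Suc i mod length vs)}) ` {..<length vs}"
    using c(2) by auto
  finally have classes: "ends G ` {e \<in> edges G. \<not> is_loop G e} =
      (\<lambda>i. {vs ! i, vs ! (Suc i mod length vs)}) ` {..<length vs}"
    using c(4) S(1) by simp
  have "verts G = vertices_of ?S (edges ?S)"
    using assms(2) S(3) by (simp add: is_cycle_graph_def)
  also have "\<dots> = (\<Union>i<length vs. {vs ! i, vs ! (Suc i mod length vs)})"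
    using classes S(1,2) by (simp add: vertices_of_def)
  also have "\<dots> = set vs"
  proof
    have "0 < length vs" using c(1,2) by simp
    then show "(\<Union>i<length vs. {vs ! i, vs ! (Suc i mod length vs)}) \<subseteq> set vs" by auto
    show "set vs \<subseteq> (\<Union>i<length vs. {vs ! i, vs ! (Suc i mod length vs)})"
      unfolding set_conv_UN_nth[of vs] by (rule UN_mono) auto
  qed
  finally have verts: "verts G = set vs" .
  then have "7 \<le> length vs" using assms(3) distinct_card[OF c(3)] by simp
  then have "fat_cycle G vs"
    using assms(1) c(3) verts classes by unfold_locales
  then show ?thesis by blast
qed

theorem theorem1p5:
  fixes G :: "('v, 'e) mgraph" and B :: "'e set set" and M :: "'e matroid"
  assumes "biased_graph G B"
    and "is_cycle_graph (simplification G)"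
    and "card (verts G) > 6"
    and "M = lift_matroid G B"
  shows "(n_connected 3 M \<longleftrightarrow>
            simple_matroid M \<and>
            card {e \<in> edges G. \<not> is_loop G e \<and> \<not> in_2_cycle G e} \<le> 1) \<and>
         (n_connected 3 M \<longrightarrow> unbreakable M)"
proof -
  have mg: "multigraph G" using assms(1) by (simp add: biased_graph_def)
  obtain vs where fc: "fat_cycle G vs" using fat_cycle_exists[OF mg assms(2,3)] by blast
  interpret fat_cycle G vs by (rule fc)
  \<comment> \<open>The description of independent sets presupposes simplicity, so here independence
    of the empty set is checked directly on \<open>lift_circuits\<close>.\<close>
  have simple: "simple_matroid M" if "n_connected 3 M"
  proof (rule n_connected_3_imp_simple[OF _ _ _ that])
    show "finite (ground M)" using finite_edges by (simp add: assms(4) lift_matroid_simps)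
    have "n \<le> card (edges G)"
      using num_classes_le_card[OF finite_edges, of "ends G" L] num_classes_edges by simp
    then show "4 \<le> card (ground M)" using len by (simp add: assms(4) lift_matroid_simps)
    have "{} \<notin> lift_circuits G B"
    proof
      assume "{} \<in> lift_circuits G B"
      then have "is_theta G {} \<or> is_cycle G {}"
        using assms(1) unfolding lift_circuits_def unbalanced_cycle_def biased_graph_def by auto
      then show False using is_thetaD(2) is_cycleD(2) by blast
    qed
    then show "indep M {}" by (simp add: assms(4) lift_matroid_simps)
  qed
  show ?thesis
  proof (cases "simple_matroid M")
    case True
    then interpret simple_fat_cycle G vs B
      using assms(1,4) by unfold_locales simp_all
    have two: "card {e \<in> edges G. \<not> is_loop G e \<and> \<not> in_2_cycle G e} \<le> 1" if "n_connected 3 M"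
      using lift.not_3_connected_two_thin that unfolding thin_unique_iff assms(4) by blast
    have "n_connected 3 M \<and> unbreakable M"
      if "card {e \<in> edges G. \<not> is_loop G e \<and> \<not> in_2_cycle G e} \<le> 1"
    proof -
      interpret thick: thick_cyclic_lift "lift_matroid G B" L "ends G" B n
        using that unfolding thin_unique_iff by unfold_locales blast
      show ?thesis using thick.three_connected thick.unbreakable_lift True assms(4) by blast
    qed
    then show ?thesis using two True by blast
  next
    case False
    then show ?thesis using simple by blast
  qed
qed

end
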